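(* Let $G$ be a $K_{3,3}$-minor free graph of order $n\geq 1186$. Then $q(G)\leq q(F_{3,3}(n))$, with equality if and only if $G=F_{3,3}(n)$. Here, writing $n-2=3p+r$ with integers $p\ge0$ and $0\le r<3$, $q(F_{3,3}(n))$ is the largest root of the equation $$x^3-(n+2r+6)x^2+(12r+4n+2rn+4)x+4r-8rn-4r^2=0.$$
   Context: All graphs are finite, simple and undirected. For a graph $G$, $Q(G)=D(G)+A(G)$ is the signless Laplacian matrix ($D(G)$ the diagonal degree matrix, $A(G)$ the adjacency matrix), and $q(G)$ denotes its largest eigenvalue. A graph $H$ is a minor of $G$ if $H$ can be obtained from $G$ by deleting edges, contracting edges, or deleting vertices; $G$ is $H$-minor free if it has no minor isomorphic to $H$. $K_{s,t}$ is the complete bipartite graph with parts of sizes $s$ and $t$, and $K_m$ the complete graph on $m$ vertices. $G\cup H$ is disjoint union, $G\vee H$ is the join, and $k\cdot G$ is the disjoint union of $k$ copies of $G$. For $2\le s\le t$, write $n-s+1=pt+r$ with $0\le r<t$, and set $F_{s,t}(n):=K_{s-1}\vee(p\cdot K_t\cup K_r)$ (where $K_0$ is the empty graph); in particular $F_{3,3}(n)=K_2\vee(p\cdot K_3\cup K_r)$ with $n-2=3p+r$. *)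

theory Defs
  imports Complex_Main
begin

type_synonym 'a graph = "'a set \<times> 'a set set"

definition verts :: "'a graph \<Rightarrow> 'a set" where "verts G = fst G"
definition edges :: "'a graph \<Rightarrow> 'a set set" where "edges G = snd G"

definition simple_graph :: "'a graph \<Rightarrow> bool" where
  "simple_graph G \<longleftrightarrow> finite (verts G) \<and>
     (\<forall>e\<in>edges G. \<exists>u v. u \<noteq> v \<and> u \<in> verts G \<and> v \<in> verts G \<and> e = {u, v})"

definition graph_iso :: "'a graph \<Rightarrow> 'b graph \<Rightarrow> bool" where
  "graph_iso G H \<longleftrightarrow> (\<exists>f. bij_betw f (verts G) (verts H) \<and>
     (\<forall>u\<in>verts G. \<forall>v\<in>verts G. {u, v} \<in> edges G \<longleftrightarrow> {f u, f v} \<in> edges H))"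

definition delete_edge :: "'a graph \<Rightarrow> 'a set \<Rightarrow> 'a graph" where
  "delete_edge G e = (verts G, edges G - {e})"

definition delete_vertex :: "'a graph \<Rightarrow> 'a \<Rightarrow> 'a graph" where
  "delete_vertex G v = (verts G - {v}, {e \<in> edges G. v \<notin> e})"

definition contract_edge :: "'a graph \<Rightarrow> 'a \<Rightarrow> 'a \<Rightarrow> 'a graph" where
  "contract_edge G u v = (verts G - {v},
     {e \<in> edges G. v \<notin> e} \<union> {{u, w} | w. {v, w} \<in> edges G \<and> w \<noteq> u})"

inductive minor_of :: "'a graph \<Rightarrow> 'a graph \<Rightarrow> bool" where
  refl: "minor_of G G"
| del_edge: "minor_of H G \<Longrightarrow> e \<in> edges H \<Longrightarrow> minor_of (delete_edge H e) G"
| del_vertex: "minor_of H G \<Longrightarrow> v \<in> verts H \<Longrightarrow> minor_of (delete_vertex H v) G"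
| contract: "minor_of H G \<Longrightarrow> {u, v} \<in> edges H \<Longrightarrow> u \<noteq> v \<Longrightarrow> minor_of (contract_edge H u v) G"

definition has_minor :: "'a graph \<Rightarrow> 'b graph \<Rightarrow> bool" where
  "has_minor G H \<longleftrightarrow> (\<exists>M. minor_of M G \<and> graph_iso M H)"

definition complete_bipartite :: "nat \<Rightarrow> nat \<Rightarrow> nat graph" where
  "complete_bipartite s t = ({..<s+t}, {{i, j} | i j. i < s \<and> s \<le> j \<and> j < s + t})"

definition degree :: "'a graph \<Rightarrow> 'a \<Rightarrow> nat" where
  "degree G v = card {u \<in> verts G. {u, v} \<in> edges G}"

definition signless_laplacian :: "'a graph \<Rightarrow> 'a \<Rightarrow> 'a \<Rightarrow> real" where
  "signless_laplacian G i j =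
     (if i = j then real (degree G i) else if {i, j} \<in> edges G then 1 else 0)"

definition is_Q_eigenvalue :: "'a graph \<Rightarrow> real \<Rightarrow> bool" where
  "is_Q_eigenvalue G x \<longleftrightarrow> (\<exists>w :: 'a \<Rightarrow> real. (\<exists>i\<in>verts G. w i \<noteq> 0) \<and>
     (\<forall>i\<in>verts G. (\<Sum>j\<in>verts G. signless_laplacian G i j * w j) = x * w i))"

definition q_index :: "'a graph \<Rightarrow> real" where
  "q_index G = Max {x. is_Q_eigenvalue G x}"

text \<open>F_{3,3}(n) = K_2 \<or> (p K_3 \<union> K_r), n - 2 = 3p + r: vertices 0..n-1, vertices 0,1
  form the K_2 joined to everything, vertices i \<ge> 2 are grouped into cliques by
  (i - 2) div 3 (the last group has r vertices).\<close>
definition F33 :: "nat \<Rightarrow> nat graph" where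
  "F33 n = ({..<n}, {{i, j} | i j. i < n \<and> j < n \<and> i \<noteq> j \<and>
      (i < 2 \<or> j < 2 \<or> (i - 2) div 3 = (j - 2) div 3)})"

end

(* A K_{3,3}-minor-free graph has degree sum below 12 n (contract edges lying in few triangles,
   then pass to a neighbourhood, twice), and three vertices have at most two common neighbours.
   Let q > n + 2 be a signless Laplacian eigenvalue and x the absolute values of an eigenvector,
   scaled to maximum 1. Summing the eigenvalue equations, and improving the bound on the sum of x three times, shows
   that the two vertices of largest degree are adjacent to all others.

   The rest H of the graph then has maximum degree 2, and all its cycles are triangles. With the
   dominating entries scaled to 1, the entries y on H satisfy
     (q - 6)(q - n) + 2 W = 2 (n - 2),   W = sum over w in H of (2 - deg_H w) y_w,
   so q is largest when the deficit W, carried by the ends of the path components, is smallest,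
   which happens for triangles and one clique on r vertices. *)
theory Submission
  imports "Jordan_Normal_Form.Spectral_Radius" Defs
begin

section \<open>Minors and edge density\<close>

text \<open>The threshold n + 2 lies just below the candidate value: the cubic is negative at n + 2,
  so a graph with index at most n + 2 needs no structural argument. Above the threshold the gap
  between q and any degree exceeds 3, and this forces the dominating pair. G need not be connected,
  so no positive eigenvector is available at the start. The absolute values of an arbitrary
  eigenvector satisfy the rows only as inequalities, which is enough to find the pair. The deficit
  identity needs equations; once the pair is known, diagonal dominance shows that the eigenvector
  itself is a multiple of a positive one. The bound on W involves no eigenvector of a second graph.
  At the index q of G the cubic equals 4r(3 - r) - 2W(q - 2r), and W is bounded below in terms of
  this same q. So the cubic is nonpositive at q, and q cannot exceed its largest root. Equality
  makes the bound on W sharp, which pins down the components.\<close>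

lemma verts_Pair [simp]: "verts (V, E) = V"
  by (simp add: verts_def)

lemma edges_Pair [simp]: "edges (V, E) = E"
  by (simp add: edges_def)

definition nbrs :: "'a graph \<Rightarrow> 'a \<Rightarrow> 'a set" where
  "nbrs G a = {b \<in> verts G. {a, b} \<in> edges G}"

lemma nbrs_iff: "b \<in> nbrs G a \<longleftrightarrow> b \<in> verts G \<and> {a, b} \<in> edges G"
  by (simp add: nbrs_def)

lemma degree_nbrs: "degree G a = card (nbrs G a)"
  by (simp add: degree_def nbrs_def insert_commute)

lemma finite_verts: "simple_graph G \<Longrightarrow> finite (verts G)"
  by (simp add: simple_graph_def)

lemma finite_nbrs: "simple_graph G \<Longrightarrow> finite (nbrs G a)"
  by (simp add: nbrs_def finite_verts)

lemma simple_edgeD: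
  assumes "simple_graph G" "{a, b} \<in> edges G"
  shows "a \<noteq> b" "a \<in> verts G" "b \<in> verts G"
  using assms unfolding simple_graph_def by (metis doubleton_eq_iff)+

lemma no_loop: "simple_graph G \<Longrightarrow> {a} \<notin> edges G"
  using simple_edgeD(1)[of G a a] by auto

lemma not_nbrs_self: "simple_graph G \<Longrightarrow> a \<notin> nbrs G a"
  by (simp add: nbrs_iff no_loop)

lemma nbrs_sym: "simple_graph G \<Longrightarrow> a \<in> nbrs G b \<longleftrightarrow> b \<in> nbrs G a"
  using simple_edgeD[of G a b] simple_edgeD[of G b a] by (auto simp: nbrs_iff insert_commute)

lemma simple_edgeE:
  assumes "simple_graph G" "e \<in> edges G"
  obtains p q where "p \<noteq> q" "p \<in> verts G" "q \<in> verts G" "e = {p, q}"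
proof -
  have "\<exists>p q. p \<noteq> q \<and> p \<in> verts G \<and> q \<in> verts G \<and> e = {p, q}"
    using assms by (simp add: simple_graph_def)
  then show ?thesis using that by (elim exE conjE)
qed

lemma simple_edges_subset: "simple_graph G \<Longrightarrow> e \<in> edges G \<Longrightarrow> e \<subseteq> verts G"
  by (erule (1) simple_edgeE) simp

lemma finite_edges: "simple_graph G \<Longrightarrow> finite (edges G)"
  by (rule finite_subset[of _ "Pow (verts G)"]) (auto dest: simple_edges_subset simp: finite_verts)

lemma simple_graphI:
  assumes "finite (verts G)"
    "\<And>e. e \<in> edges G \<Longrightarrow> \<exists>u v. u \<noteq> v \<and> u \<in> verts G \<and> v \<in> verts G \<and> e = {u, v}"
  shows "simple_graph G"
  using assms unfolding simple_graph_def by blast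

section \<open>Minors obtained by deletion\<close>

lemma minor_of_trans: "minor_of M H \<Longrightarrow> minor_of H G \<Longrightarrow> minor_of M G"
  by (induction rule: minor_of.induct) (auto intro: minor_of.intros)

lemma has_minor_minor: "minor_of M G \<Longrightarrow> has_minor M K \<Longrightarrow> has_minor G K"
  unfolding has_minor_def by (blast intro: minor_of_trans)

lemma minor_of_delete_edges:
  assumes "finite S" "S \<subseteq> E"
  shows "minor_of (V, E - S) (V, E)"
  using assms
proof (induction S rule: finite_induct)
  case empty
  then show ?case by (simp add: minor_of.refl)
next
  case (insert e S)
  then have "minor_of (delete_edge (V, E - S) e) (V, E)"
    by (intro minor_of.del_edge) (auto simp: edges_def)
  moreover have "delete_edge (V, E - S) e = (V, E - insert e S)"
    by (auto simp: delete_edge_def verts_def edges_def)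
  ultimately show ?case by simp
qed

lemma minor_of_delete_vertices:
  assumes "finite S" "S \<subseteq> V"
  shows "minor_of (V - S, {e \<in> E. e \<inter> S = {}}) (V, E)"
  using assms
proof (induction S rule: finite_induct)
  case empty
  then show ?case by (simp add: minor_of.refl)
next
  case (insert v S)
  then have "minor_of (delete_vertex (V - S, {e \<in> E. e \<inter> S = {}}) v) (V, E)"
    by (intro minor_of.del_vertex) (auto simp: verts_def)
  moreover have "delete_vertex (V - S, {e \<in> E. e \<inter> S = {}}) v
      = (V - insert v S, {e \<in> E. e \<inter> insert v S = {}})"
    by (auto simp: delete_vertex_def verts_def edges_def)
  ultimately show ?case by simp
qed

text \<open>Deleting the vertices outside \<open>V'\<close> first removes every edge that leaves
  \<open>V'\<close>; what remains is to delete the edges not in \<open>E'\<close>.\<close>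

lemma minor_of_subgraph:
  assumes G: "simple_graph G" and V: "V' \<subseteq> verts G" and E: "E' \<subseteq> edges G"
    and sub: "\<And>e. e \<in> E' \<Longrightarrow> e \<subseteq> V'"
  shows "minor_of (V', E') G"
proof -
  let ?S = "verts G - V'"
  let ?E = "{e \<in> edges G. e \<inter> ?S = {}}"
  have "minor_of (verts G - ?S, ?E) (verts G, edges G)"
    by (rule minor_of_delete_vertices) (use G in \<open>auto simp: finite_verts\<close>)
  moreover have "verts G - ?S = V'" using V by auto
  ultimately have 1: "minor_of (V', ?E) G"
    by (simp add: verts_def edges_def)
  have "minor_of (V', ?E - (?E - E')) (V', ?E)"
    by (rule minor_of_delete_edges) (use G in \<open>auto simp: finite_edges\<close>)
  moreover have "?E - (?E - E') = E'" using E sub by auto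
  ultimately have "minor_of (V', E') (V', ?E)" by simp
  then show ?thesis using 1 by (rule minor_of_trans)
qed

text \<open>The copy need not be induced: edges inside \<open>A\<close> or inside \<open>B\<close>
  are deleted along with all other vertices. The two sides are numbered 0..2 and 3..5 to match
  \<open>complete_bipartite\<close>.\<close>

lemma K33_subgraph_has_minor:
  assumes G: "simple_graph G" and "card A = 3" "card B = 3" "A \<inter> B = {}"
    and sub: "A \<subseteq> verts G" "B \<subseteq> verts G"
    and AB: "\<And>a b. a \<in> A \<Longrightarrow> b \<in> B \<Longrightarrow> {a, b} \<in> edges G"
  shows "has_minor G (complete_bipartite 3 3)"
proof -
  have fin: "finite A" "finite B" using assms(2,3) by (auto intro: card_ge_0_finite)
  obtain f where f: "bij_betw f A {..<3::nat}"
    using finite_same_card_bij[of A "{..<3::nat}"] fin assms by auto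
  obtain g where g: "bij_betw g B {3..<6::nat}"
    using finite_same_card_bij[of B "{3..<6::nat}"] fin assms by auto
  define h where "h x = (if x \<in> A then f x else g x)" for x
  define E where "E = {{a, b} | a b. a \<in> A \<and> b \<in> B}"
  have m: "minor_of (A \<union> B, E) G"
    by (rule minor_of_subgraph[OF G]) (use sub AB in \<open>auto simp: E_def\<close>)
  have hA: "bij_betw h A {..<3}" using f by (simp add: h_def cong: bij_betw_cong)
  have hB: "bij_betw h B {3..<6}"
    using g assms(4) by (subst bij_betw_cong[of _ h g]) (auto simp: h_def)
  have h: "bij_betw h (A \<union> B) {..<3+3}"
  proof -
    have un: "{..<3} \<union> {3..<6} = {..<3+3::nat}" by auto
    have "bij_betw h (A \<union> B) ({..<3} \<union> {3..<6})"
      by (rule bij_betw_combine[OF hA hB]) auto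
    then show ?thesis unfolding un .
  qed
  have hA': "h x < 3" if "x \<in> A" for x using hA that by (auto simp: bij_betw_def)
  have hB': "3 \<le> h x \<and> h x < 6" if "x \<in> B" for x using hB that by (auto simp: bij_betw_def)
  have "{u, v} \<in> E \<longleftrightarrow> {h u, h v} \<in> edges (complete_bipartite 3 3)"
    if uv: "u \<in> A \<union> B" "v \<in> A \<union> B" for u v
  proof -
    have "{u, v} \<in> E \<longleftrightarrow> (u \<in> A \<and> v \<in> B) \<or> (v \<in> A \<and> u \<in> B)"
      unfolding E_def by (auto simp: doubleton_eq_iff)
    also have "\<dots> \<longleftrightarrow> (h u < 3 \<and> 3 \<le> h v \<and> h v < 6) \<or> (h v < 3 \<and> 3 \<le> h u \<and> h u < 6)"
      using uv hA' hB' assms(4) by (metis UnE not_le)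
    also have "\<dots> \<longleftrightarrow> {h u, h v} \<in> edges (complete_bipartite 3 3)"
      unfolding complete_bipartite_def edges_def by (auto simp: doubleton_eq_iff)
    finally show ?thesis .
  qed
  then have "graph_iso (A \<union> B, E) (complete_bipartite 3 3)"
    unfolding graph_iso_def using h
    by (intro exI[of _ h]) (auto simp: verts_def edges_def complete_bipartite_def)
  with m show ?thesis unfolding has_minor_def by blast
qed

section \<open>Edge contraction and edge density outside a joined set\<close>

lemma verts_contract: "verts (contract_edge G x y) = verts G - {y}"
  by (simp add: contract_edge_def verts_def)

lemma edges_contract:
  assumes "a \<noteq> y" "b \<noteq> y"
  shows "{a, b} \<in> edges (contract_edge G x y) \<longleftrightarrow>
    {a, b} \<in> edges G \<or> (a = x \<and> b \<noteq> x \<and> {y, b} \<in> edges G) \<or> (b = x \<and> a \<noteq> x \<and> {y, a} \<in> edges G)"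
  using assms by (auto simp: contract_edge_def edges_def doubleton_eq_iff)

lemma simple_contract:
  assumes G: "simple_graph G" and xy: "{x, y} \<in> edges G"
  shows "simple_graph (contract_edge G x y)"
proof (rule simple_graphI)
  show "finite (verts (contract_edge G x y))" using G by (simp add: verts_contract finite_verts)
next
  fix e assume e: "e \<in> edges (contract_edge G x y)"
  then have "e \<in> {e \<in> edges G. y \<notin> e} \<union> {{x, w} | w. {y, w} \<in> edges G \<and> w \<noteq> x}"
    by (simp add: contract_edge_def edges_def)
  then consider "e \<in> edges G" "y \<notin> e" | w where "e = {x, w}" "{y, w} \<in> edges G" "w \<noteq> x"
    by blast
  then show "\<exists>u v. u \<noteq> v \<and> u \<in> verts (contract_edge G x y) \<and> v \<in> verts (contract_edge G x y) \<and> e = {u, v}"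
  proof cases
    case 1
    obtain u v where "u \<noteq> v" "u \<in> verts G" "v \<in> verts G" "e = {u, v}"
      by (rule simple_edgeE[OF G 1(1)])
    then show ?thesis using 1 by (auto simp: verts_contract)
  next
    case 2
    then show ?thesis using simple_edgeD[OF G xy] simple_edgeD[OF G 2(2)]
      by (intro exI[of _ x] exI[of _ w]) (auto simp: verts_contract)
  qed
qed

text \<open>\<open>D\<close> collects vertices of one side of the future K_{3,3}; hence only edges
  from \<open>D\<close> to the outside are recorded.\<close>

definition joined :: "'a graph \<Rightarrow> 'a set \<Rightarrow> bool" where
  "joined G D \<longleftrightarrow> D \<subseteq> verts G \<and> (\<forall>d\<in>D. \<forall>w\<in>verts G - D. {d, w} \<in> edges G)"

text \<open>The contraction loses the edge \<open>{x, y}\<close> and, at each common neighbour,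
  merges two edges into one. Every lost edge counts twice in the degree sum.\<close>

lemma sum_card_nbrs_contract:
  fixes G :: "'a graph"
  assumes G: "simple_graph G" and W: "W \<subseteq> verts G" and xy: "x \<in> W" "y \<in> W" "{x, y} \<in> edges G"
  defines "M \<equiv> contract_edge G x y"
  shows "(\<Sum>w\<in>W. card (nbrs G w \<inter> W))
    = (\<Sum>w\<in>W - {y}. card (nbrs M w \<inter> (W - {y}))) + 2 + 2 * card (nbrs G x \<inter> nbrs G y \<inter> W)"
proof -
  have fW: "finite W" using W G finite_subset finite_verts by blast
  have ne: "x \<noteq> y" using simple_edgeD[OF G xy(3)] by simp
  have M: "simple_graph M" unfolding M_def by (rule simple_contract[OF G xy(3)])
  let ?C = "nbrs G x \<inter> nbrs G y \<inter> W"
  have selfx: "x \<notin> nbrs G x" "y \<notin> nbrs G y" using not_nbrs_self[OF G] by auto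
  note sym = nbrs_sym[OF G]
  have xyn: "y \<in> nbrs G x" "x \<in> nbrs G y" using simple_edgeD[OF G xy(3)] xy by (auto simp: nbrs_iff insert_commute)
  have nx: "nbrs M x \<inter> (W - {y}) = ((nbrs G x \<inter> W) \<union> (nbrs G y \<inter> W)) - {x, y}"
    using ne W no_loop[OF G] no_loop[OF M]
    by (auto simp: nbrs_iff M_def edges_contract verts_contract insert_commute)
  have fx: "finite (nbrs G x \<inter> W)" "finite (nbrs G y \<inter> W)" using fW by auto
  have cx: "card (nbrs M x \<inter> (W - {y})) + 2 + card ?C = card (nbrs G x \<inter> W) + card (nbrs G y \<inter> W)"
  proof -
    let ?U = "(nbrs G x \<inter> W) \<union> (nbrs G y \<inter> W)"
    have "{x, y} \<subseteq> ?U" using xyn xy by auto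
    then have "card (?U - {x, y}) = card ?U - 2" "card ?U \<ge> 2"
      using ne fx card_Diff_subset[of "{x,y}" ?U] card_mono[of ?U "{x,y}"] by auto
    moreover have "card (nbrs G x \<inter> W) + card (nbrs G y \<inter> W) = card ?U + card ?C"
      using card_Un_Int[OF fx] by (simp add: Int_ac)
    ultimately show ?thesis using nx by simp
  qed
  \<comment> \<open>For \<open>a\<close> other than \<open>x\<close>, \<open>y\<close> the
    contraction renames a neighbour \<open>y\<close> to \<open>x\<close>; the degree drops exactly
    when \<open>x\<close> was a neighbour already.\<close>
  have co: "card (nbrs G a \<inter> W) = card (nbrs M a \<inter> (W - {y})) + (if a \<in> ?C then 1 else 0)"
    if a: "a \<in> W - {x, y}" for a
  proof -
    have na: "nbrs M a \<inter> (W - {y}) = (nbrs G a \<inter> W - {y}) \<union> (if y \<in> nbrs G a then {x} else {})"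
    proof (rule Set.set_eqI)
      fix b
      show "b \<in> nbrs M a \<inter> (W - {y}) \<longleftrightarrow>
          b \<in> (nbrs G a \<inter> W - {y}) \<union> (if y \<in> nbrs G a then {x} else {})"
      proof (cases "b = y")
        case False
        then show ?thesis using a ne xy W edges_contract[of a y b G x]
          by (auto simp: nbrs_iff M_def verts_contract insert_commute)
      qed (use ne in simp)
    qed
    have fa: "finite (nbrs G a \<inter> W)" using fW by auto
    consider "y \<notin> nbrs G a" | "y \<in> nbrs G a" "x \<in> nbrs G a" | "y \<in> nbrs G a" "x \<notin> nbrs G a" by blast
    then show ?thesis
    proof cases
      case 1
      then show ?thesis using na sym[of a y] by simp
    next
      case 2
      then have "a \<in> ?C" using sym a by auto
      moreover have "nbrs M a \<inter> (W - {y}) = nbrs G a \<inter> W - {y}" using na 2 xy ne by auto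
      moreover have "y \<in> nbrs G a \<inter> W" using 2 xy by auto
      ultimately show ?thesis using card.remove[OF fa, of y] by simp
    next
      case 3
      then have "a \<notin> ?C" using sym a by auto
      moreover have "nbrs M a \<inter> (W - {y}) = insert x (nbrs G a \<inter> W - {y})" using na 3 by auto
      moreover have "y \<in> nbrs G a \<inter> W" "x \<notin> nbrs G a \<inter> W - {y}" using 3 xy by auto
      ultimately show ?thesis using fa card.remove[OF fa, of y] by simp
    qed
  qed
  have split1: "(\<Sum>w\<in>W. f w) = f x + f y + (\<Sum>w\<in>W - {x, y}. f w)" for f :: "'a \<Rightarrow> nat"
    using fW xy ne by (simp add: sum.remove[of W x] sum.remove[of "W - {x}" y] Diff_insert2[symmetric] insert_commute)
  have split2: "(\<Sum>w\<in>W - {y}. f w) = f x + (\<Sum>w\<in>W - {x, y}. f w)" for f :: "'a \<Rightarrow> nat"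
    using fW xy ne sum.remove[of "W - {y}" x f] by (simp add: Diff_insert2[symmetric] insert_commute)
  have C: "?C \<subseteq> W - {x, y}" using selfx by auto
  have "(\<Sum>w\<in>W - {x, y}. card (nbrs G w \<inter> W))
      = (\<Sum>w\<in>W - {x, y}. card (nbrs M w \<inter> (W - {y}))) + (\<Sum>w\<in>W - {x, y}. if w \<in> ?C then 1 else 0)"
    using co by (simp add: sum.distrib)
  also have "(\<Sum>w\<in>W - {x, y}. if w \<in> ?C then 1 else (0::nat)) = card ?C"
    using C fW sum.inter_restrict[of "W - {x, y}" "\<lambda>_. 1::nat" ?C] by (simp add: Int_absorb1 del: Int_iff)
  finally show ?thesis using split1[of "\<lambda>w. card (nbrs G w \<inter> W)"]
      split2[of "\<lambda>w. card (nbrs M w \<inter> (W - {y}))"] cx by simp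
qed

lemma joined_contract:
  assumes G: "simple_graph G" and J: "joined G D" and xy: "x \<notin> D" "y \<notin> D"
  shows "joined (contract_edge G x y) D"
  unfolding joined_def
proof (intro conjI ballI)
  show "D \<subseteq> verts (contract_edge G x y)" using J xy by (auto simp: joined_def verts_contract)
next
  fix d w assume "d \<in> D" "w \<in> verts (contract_edge G x y) - D"
  then show "{d, w} \<in> edges (contract_edge G x y)"
    using J xy edges_contract[of d y w G x] by (auto simp: joined_def verts_contract)
qed

text \<open>The sum counts edges outside \<open>D\<close> twice, so the condition asks for at least
  \<open>c\<close> edges per vertex there.\<close>

definition dense_outside :: "nat \<Rightarrow> 'a set \<Rightarrow> 'a graph \<Rightarrow> bool" where
  "dense_outside c D G \<longleftrightarrow> simple_graph G \<and> joined G D \<and> verts G - D \<noteq> {} \<and>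
     2 * c * card (verts G - D) \<le> (\<Sum>w\<in>verts G - D. card (nbrs G w \<inter> (verts G - D)))"

text \<open>As long as some edge outside \<open>D\<close> lies in fewer than \<open>c\<close> triangles, contracting it does
  not decrease the density outside \<open>D\<close> below \<open>c\<close>.\<close>
lemma dense_minor_many_triangles:
  fixes G :: "'a graph"
  assumes "dense_outside c D G"
  shows "\<exists>M. minor_of M G \<and> dense_outside c D M \<and>
     (\<forall>x\<in>verts M - D. \<forall>y\<in>verts M - D. {x, y} \<in> edges M \<longrightarrow>
        c \<le> card (nbrs M x \<inter> nbrs M y \<inter> (verts M - D)))"
  using assms
proof (induction "card (verts G)" arbitrary: G rule: less_induct)
  case less
  have G: "simple_graph G" and J: "joined G D"
    and S0: "2 * c * card (verts G - D) \<le> (\<Sum>w\<in>verts G - D. card (nbrs G w \<inter> (verts G - D)))"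
    using less.prems by (simp_all add: dense_outside_def)
  show ?case
  proof (cases "\<forall>x\<in>verts G - D. \<forall>y\<in>verts G - D. {x, y} \<in> edges G \<longrightarrow>
        c \<le> card (nbrs G x \<inter> nbrs G y \<inter> (verts G - D))")
    case True
    then show ?thesis by (intro exI[of _ G] conjI minor_of.refl less.prems)
  next
    case False
    then obtain x y where xy: "x \<in> verts G - D" "y \<in> verts G - D" "{x, y} \<in> edges G"
      and t: "card (nbrs G x \<inter> nbrs G y \<inter> (verts G - D)) < c" by (meson not_le)
    let ?M = "contract_edge G x y"
    have ne: "x \<noteq> y" using simple_edgeD[OF G xy(3)] by simp
    have M: "simple_graph ?M" by (rule simple_contract[OF G xy(3)])
    have JM: "joined ?M D" by (rule joined_contract[OF G J]) (use xy in auto)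
    have V: "verts ?M - D = verts G - D - {y}" by (auto simp: verts_contract)
    have fV: "finite (verts G - D)" using G by (simp add: finite_verts)
    have cV: "card (verts G - D) = Suc (card (verts ?M - D))"
      unfolding V using card.remove[OF fV xy(2)] .
    have "(\<Sum>w\<in>verts G - D. card (nbrs G w \<inter> (verts G - D)))
      = (\<Sum>w\<in>verts ?M - D. card (nbrs ?M w \<inter> (verts ?M - D))) + 2
        + 2 * card (nbrs G x \<inter> nbrs G y \<inter> (verts G - D))"
      unfolding V by (rule sum_card_nbrs_contract[OF G _ xy]) simp
    \<comment> \<open>With at most \<open>c - 1\<close> triangles on \<open>{x, y}\<close> the
      degree sum drops by at most 2 + 2(c - 1) = 2c, which is the share of the one vertex that
      disappears.\<close>
    then have S: "2 * c * card (verts ?M - D) \<le> (\<Sum>w\<in>verts ?M - D. card (nbrs ?M w \<inter> (verts ?M - D)))"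
      using S0 t cV by (simp add: algebra_simps)
    have less: "card (verts ?M) < card (verts G)"
      unfolding verts_contract using xy G card_Diff1_less[of "verts G" y] by (simp add: finite_verts)
    have "verts ?M - D \<noteq> {}" using V xy ne by auto
    then have "dense_outside c D ?M" using M JM S by (simp add: dense_outside_def)
    from less.hyps[OF less this] obtain M' where MM: "minor_of M' ?M"
      and M': "dense_outside c D M' \<and> (\<forall>x\<in>verts M' - D. \<forall>y\<in>verts M' - D. {x, y} \<in> edges M' \<longrightarrow>
        c \<le> card (nbrs M' x \<inter> nbrs M' y \<inter> (verts M' - D)))"
      by (elim exE conjE) (rule that; assumption?; intro conjI; assumption)
    have "minor_of ?M G" using xy ne by (intro minor_of.contract minor_of.refl)
    with MM have "minor_of M' G" by (rule minor_of_trans)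
    then show ?thesis by (intro exI[of _ M'] conjI[OF _ M'])
  qed
qed

text \<open>In the minor with many triangles, restrict to \<open>D\<close>, a vertex
  \<open>x\<close> of positive degree outside \<open>D\<close>, and the neighbourhood of
  \<open>x\<close> there. Each neighbour \<open>w\<close> shares at least \<open>c\<close> triangles
  with \<open>x\<close>, and their third vertices are neighbours of \<open>w\<close> that survive
  the restriction. Thus \<open>x\<close> joins \<open>D\<close>, at the price of turning density
  \<open>c\<close> into minimum degree \<open>c\<close>.\<close>

lemma dense_minor_joined:
  fixes G :: "'a graph"
  assumes "dense_outside c D G" "c > 0"
  obtains M x where "minor_of M G" "simple_graph M" "x \<notin> D" "joined M (insert x D)"
    "verts M - insert x D \<noteq> {}"
    "\<And>w. w \<in> verts M - insert x D \<Longrightarrow> c \<le> card (nbrs M w \<inter> (verts M - insert x D))"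
proof -
  obtain M where MG: "minor_of M G" and "dense_outside c D M"
    and tri: "\<forall>x\<in>verts M - D. \<forall>y\<in>verts M - D. {x, y} \<in> edges M \<longrightarrow>
        c \<le> card (nbrs M x \<inter> nbrs M y \<inter> (verts M - D))"
    using dense_minor_many_triangles[OF assms(1)] by (elim exE conjE) (rule that; assumption)
  then have M: "simple_graph M" and J: "joined M D" and ne: "verts M - D \<noteq> {}"
    and S: "2 * c * card (verts M - D) \<le> (\<Sum>w\<in>verts M - D. card (nbrs M w \<inter> (verts M - D)))"
    by (simp_all add: dense_outside_def)
  let ?W = "verts M - D"
  have "finite ?W" using M by (simp add: finite_verts)
  then have "card ?W > 0" using ne by (simp add: card_gt_0_iff)
  \<comment> \<open>Positivity of \<open>c\<close> is what produces an edge, hence a non-isolated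
    \<open>x\<close>.\<close>
  then have "2 * c * card ?W > 0" using \<open>c > 0\<close> by simp
  then have "(\<Sum>w\<in>?W. card (nbrs M w \<inter> ?W)) \<noteq> 0" using S by linarith
  then obtain x where x: "x \<in> ?W" "card (nbrs M x \<inter> ?W) \<noteq> 0"
    by (elim sum.not_neutral_contains_not_neutral)
  let ?N = "nbrs M x \<inter> ?W"
  have xN: "x \<notin> ?N" using not_nbrs_self[OF M] by auto
  have N0: "?N \<noteq> {}" using x by (metis card.empty)
  let ?V = "insert x D \<union> ?N"
  let ?E = "{e \<in> edges M. e \<subseteq> ?V}"
  let ?K = "(?V, ?E)"
  have DV: "D \<subseteq> verts M" using J by (simp add: joined_def)
  have K: "minor_of ?K M" using M x DV by (intro minor_of_subgraph) (auto simp: nbrs_iff)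
  have VK: "verts ?K = ?V" "edges ?K = ?E" by simp_all
  have Ks: "simple_graph ?K"
  proof (rule simple_graphI)
    show "finite (verts ?K)" unfolding VK
      by (rule finite_subset[of _ "verts M"]) (use M x DV in \<open>auto simp: finite_verts\<close>)
  next
    fix e assume "e \<in> edges ?K"
    then have e: "e \<in> edges M" "e \<subseteq> ?V" by simp_all
    obtain u v where "u \<noteq> v" "e = {u, v}" by (rule simple_edgeE[OF M e(1)])
    then show "\<exists>u v. u \<noteq> v \<and> u \<in> verts ?K \<and> v \<in> verts ?K \<and> e = {u, v}"
      using e(2) unfolding VK by blast
  qed
  have rest: "verts ?K - insert x D = ?N" using xN unfolding VK by auto
  have JK: "joined ?K (insert x D)"
    unfolding joined_def rest using J by (auto simp: joined_def nbrs_iff)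
  have cK: "c \<le> card (nbrs ?K w \<inter> (verts ?K - insert x D))" if "w \<in> verts ?K - insert x D" for w
  proof -
    have w: "w \<in> ?N" using that unfolding rest .
    have "nbrs ?K w \<inter> ?N = nbrs M x \<inter> nbrs M w \<inter> ?W"
      using w by (auto simp: nbrs_iff)
    moreover have "c \<le> card (nbrs M x \<inter> nbrs M w \<inter> ?W)"
      using tri w x(1) by (auto simp: nbrs_iff)
    ultimately show ?thesis unfolding rest by simp
  qed
  have "x \<notin> D" "verts ?K - insert x D \<noteq> {}" using x(1) N0 unfolding rest by simp_all
  from that[OF minor_of_trans[OF K MG] Ks this(1) JK this(2) cK] show ?thesis .
qed

text \<open>Otherwise there are 6 edges per vertex. One neighbourhood step leaves minimum degree 6
  outside \<open>x\<close>, that is 3 edges per vertex; a second step leaves minimum degree 3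
  outside \<open>x\<close>, \<open>y\<close>. Any further vertex \<open>z\<close> with three of its
  neighbours completes K_{3,3}.\<close>

theorem sum_degree_less:
  fixes G :: "'a graph"
  assumes G: "simple_graph G" and ne: "verts G \<noteq> {}" and K: "\<not> has_minor G (complete_bipartite 3 3)"
  shows "(\<Sum>w\<in>verts G. degree G w) < 12 * card (verts G)"
proof (rule ccontr)
  assume "\<not> ?thesis"
  moreover have "nbrs G w \<inter> verts G = nbrs G w" for w by (auto simp: nbrs_def)
  ultimately have "(\<Sum>w\<in>verts G - {}. card (nbrs G w \<inter> (verts G - {}))) \<ge> 2 * 6 * card (verts G - {})"
    by (simp add: degree_nbrs)
  moreover have "joined G {}" by (simp add: joined_def)
  ultimately have "dense_outside 6 {} G" using G ne by (simp add: dense_outside_def)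
  then obtain M x where M: "minor_of M G" "simple_graph M" "x \<notin> {}" "joined M {x}" "verts M - {x} \<noteq> {}"
    and d: "\<And>w. w\<in>verts M - {x} \<Longrightarrow> 6 \<le> card (nbrs M w \<inter> (verts M - {x}))"
    by (elim dense_minor_joined[OF _ zero_less_numeral]) blast
  have "(\<Sum>w\<in>verts M - {x}. 6) \<le> (\<Sum>w\<in>verts M - {x}. card (nbrs M w \<inter> (verts M - {x})))"
    by (intro sum_mono d)
  then have "dense_outside 3 {x} M" using M by (simp add: dense_outside_def)
  then obtain N y where N: "minor_of N M" "simple_graph N" "y \<notin> {x}" "joined N {y, x}" "verts N - {y, x} \<noteq> {}"
    and dN: "\<And>w. w\<in>verts N - {y, x} \<Longrightarrow> 3 \<le> card (nbrs N w \<inter> (verts N - {y, x}))"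
    by (elim dense_minor_joined[OF _ zero_less_numeral]) blast
  obtain z where z: "z \<in> verts N - {y, x}" using N by blast
  obtain B where B: "B \<subseteq> nbrs N z \<inter> (verts N - {y, x})" "card B = 3"
    using obtain_subset_with_card_n[OF dN[OF z]] by blast
  have zB: "z \<notin> B" using B not_nbrs_self[OF N(2)] by auto
  have "has_minor N (complete_bipartite 3 3)"
  proof (rule K33_subgraph_has_minor[OF N(2), of "{x, y, z}" B])
    show "card {x, y, z} = 3" using N(3) z by auto
    show "{x, y, z} \<inter> B = {}" using B zB by auto
    show "{x, y, z} \<subseteq> verts N" using N(4) z by (auto simp: joined_def)
    show "{a, b} \<in> edges N" if "a \<in> {x, y, z}" "b \<in> B" for a b
      using that B N(4) by (auto simp: joined_def nbrs_iff subset_eq)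
  qed (use B in auto)
  from has_minor_minor[OF M(1) has_minor_minor[OF N(1) this]] K show False by simp
qed

section \<open>Signless Laplacian eigenvalues\<close>

lemma sum_signless_laplacian:
  assumes G: "simple_graph G" and i: "i \<in> verts G"
  shows "(\<Sum>j\<in>verts G. signless_laplacian G i j * w j)
    = real (degree G i) * w i + (\<Sum>j\<in>nbrs G i. w j)"
proof -
  have "(\<Sum>j\<in>verts G. signless_laplacian G i j * w j)
      = signless_laplacian G i i * w i + (\<Sum>j\<in>verts G - {i}. signless_laplacian G i j * w j)"
    using finite_verts[OF G] i by (rule sum.remove)
  also have "(\<Sum>j\<in>verts G - {i}. signless_laplacian G i j * w j)
      = (\<Sum>j\<in>verts G - {i}. if j \<in> nbrs G i then w j else 0)"
    by (intro sum.cong) (auto simp: signless_laplacian_def nbrs_iff)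
  also have "\<dots> = (\<Sum>j\<in>(verts G - {i}) \<inter> nbrs G i. w j)"
    using finite_verts[OF G] by (intro sum.inter_restrict[symmetric]) simp
  also have "(verts G - {i}) \<inter> nbrs G i = nbrs G i"
    using no_loop[OF G] by (auto simp: nbrs_iff)
  finally show ?thesis by (simp add: signless_laplacian_def)
qed

lemma is_Q_eigenvalue_iff:
  assumes G: "simple_graph G"
  shows "is_Q_eigenvalue G x \<longleftrightarrow> (\<exists>w. (\<exists>i\<in>verts G. w i \<noteq> 0) \<and>
     (\<forall>i\<in>verts G. real (degree G i) * w i + (\<Sum>j\<in>nbrs G i. w j) = x * w i))"
  unfolding is_Q_eigenvalue_def by (simp add: sum_signless_laplacian[OF G])

lemma signless_laplacian_sym: "signless_laplacian G i j = signless_laplacian G j i"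
  by (simp add: signless_laplacian_def insert_commute)

text \<open>The spectrum of a complex matrix is finite and nonempty, and for a real symmetric
  matrix it is real.\<close>
lemma Q_eigenvalues_finite_nonempty:
  fixes G :: "'a graph"
  assumes G: "simple_graph G" and ne: "verts G \<noteq> {}"
  shows "finite {x. is_Q_eigenvalue G x}" "{x. is_Q_eigenvalue G x} \<noteq> {}"
proof -
  define n where "n = card (verts G)"
  have n: "n \<noteq> 0" using ne finite_verts[OF G] by (simp add: n_def)
  obtain f where f: "bij_betw f {0..<n} (verts G)"
    using ex_bij_betw_nat_finite[OF finite_verts[OF G]] by (auto simp: n_def)
  define q where "q a b = signless_laplacian G (f a) (f b)" for a b
  define A :: "complex mat" where "A = mat n n (\<lambda>(a, b). complex_of_real (q a b))"
  have A: "A \<in> carrier_mat n n" by (simp add: A_def)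
  have Av: "(A *\<^sub>v v) $ a = (\<Sum>b\<in>{0..<n}. complex_of_real (q a b) * v $ b)"
    if "v \<in> carrier_vec n" "a < n" for v a
    using that by (simp add: A_def scalar_prod_def)
  have qf: "(\<Sum>b\<in>{0..<n}. q a b * w (f b)) = (\<Sum>j\<in>verts G. signless_laplacian G (f a) j * w j)" for a w
    unfolding q_def by (rule sum.reindex_bij_betw[OF f])
  have fV: "f a \<in> verts G" if "a < n" for a using f that by (auto simp: bij_betw_def)
  \<comment> \<open>Finiteness: real eigenvalues embed injectively into the finite complex
    spectrum.\<close>
  have "complex_of_real ` {x. is_Q_eigenvalue G x} \<subseteq> spectrum A"
  proof clarify
    fix x assume "is_Q_eigenvalue G x"
    then obtain w where w0: "\<exists>i\<in>verts G. w i \<noteq> 0"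
      and w: "\<And>i. i \<in> verts G \<Longrightarrow> (\<Sum>j\<in>verts G. signless_laplacian G i j * w j) = x * w i"
      unfolding is_Q_eigenvalue_def by blast
    define v where "v = vec n (\<lambda>a. complex_of_real (w (f a)))"
    have v: "v \<in> carrier_vec n" by (simp add: v_def)
    obtain i where i: "i \<in> verts G" "w i \<noteq> 0" using w0 by blast
    obtain a where a: "a < n" "w (f a) \<noteq> 0" 
      using i bij_betw_imp_surj_on[OF f] by (metis atLeastLessThan_iff imageE)
    then have v0: "v \<noteq> 0\<^sub>v n" by (auto simp: v_def vec_eq_iff)
    have "A *\<^sub>v v = complex_of_real x \<cdot>\<^sub>v v"
    proof (rule eq_vecI)
      show "dim_vec (A *\<^sub>v v) = dim_vec (complex_of_real x \<cdot>\<^sub>v v)" by (simp add: A_def v_def)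
    next
      fix a assume "a < dim_vec (complex_of_real x \<cdot>\<^sub>v v)"
      then have a: "a < n" by (simp add: v_def)
      have "(A *\<^sub>v v) $ a = complex_of_real (\<Sum>b\<in>{0..<n}. q a b * w (f b))"
        using Av[OF v a] by (simp add: v_def)
      also have "\<dots> = complex_of_real (x * w (f a))" using qf w[OF fV[OF a]] by simp
      finally show "(A *\<^sub>v v) $ a = (complex_of_real x \<cdot>\<^sub>v v) $ a" using a by (simp add: v_def)
    qed
    then show "complex_of_real x \<in> spectrum A"
      using v v0 A unfolding spectrum_def eigenvalue_def eigenvector_def by auto
  qed
  then show "finite {x. is_Q_eigenvalue G x}"
    using card_finite_spectrum(1)[OF A] finite_subset finite_imageD inj_of_real inj_on_subset subset_UNIV
    by meson
  have q_sym: "q a b = q b a" for a b by (simp add: q_def signless_laplacian_sym)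
  obtain k where "k \<in> spectrum A" using spectrum_non_empty[OF A] n by blast
  then obtain v where v: "v \<in> carrier_vec n" "v \<noteq> 0\<^sub>v n" "A *\<^sub>v v = k \<cdot>\<^sub>v v"
    using A unfolding spectrum_def eigenvalue_def eigenvector_def by auto
  have ev: "(\<Sum>b\<in>{0..<n}. complex_of_real (q a b) * v $ b) = k * v $ a" if "a < n" for a
  proof -
    have "(A *\<^sub>v v) $ a = (\<Sum>b\<in>{0..<n}. complex_of_real (q a b) * v $ b)"
      using that v(1) by (simp add: A_def scalar_prod_def)
    then show ?thesis using v that by simp
  qed
  obtain a0 where a0: "a0 < n" "v $ a0 \<noteq> 0" using v by (auto simp: vec_eq_iff)
  \<comment> \<open>\<open>S\<close> is the Hermitian form of \<open>A\<close> at \<open>v\<close>.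
    It equals \<open>k * N\<close> and, as \<open>q\<close> is real and symmetric, its own
    conjugate; so \<open>k\<close> is real.\<close>
  define S where "S = (\<Sum>a\<in>{0..<n}. \<Sum>b\<in>{0..<n}. cnj (v $ a) * (complex_of_real (q a b) * v $ b))"
  define N where "N = (\<Sum>a\<in>{0..<n}. (cmod (v $ a))\<^sup>2)"
  have "S = (\<Sum>a\<in>{0..<n}. cnj (v $ a) * (k * v $ a))"
    unfolding S_def sum_distrib_left[symmetric] using ev by (intro sum.cong) auto
  also have "\<dots> = k * complex_of_real N"
    unfolding N_def of_real_sum sum_distrib_left
    by (intro sum.cong) (simp_all add: complex_norm_square mult_ac del: of_real_power)
  finally have SN: "S = k * complex_of_real N" .
  have "cnj S = (\<Sum>a\<in>{0..<n}. \<Sum>b\<in>{0..<n}. cnj (v $ b) * (complex_of_real (q b a) * v $ a))"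
    unfolding S_def by (simp add: mult_ac q_sym)
  also have "\<dots> = S" unfolding S_def by (rule sum.swap)
  finally have "cnj k * complex_of_real N = k * complex_of_real N" using SN by simp
  moreover have "N > 0"
    unfolding N_def by (rule sum_pos2[of _ a0]) (use a0 in auto)
  ultimately have "cnj k = k" by simp
  then have k: "k = complex_of_real (Re k)" by (simp add: complex_eq_iff)
  define g where "g = inv_into {0..<n} f"
  have gf: "g (f a) = a" if "a < n" for a
    unfolding g_def using f that by (intro inv_into_f_f) (auto simp: bij_betw_def)
  \<comment> \<open>Here \<open>h\<close> is a real-linear functional, used as \<open>Re\<close> and
    \<open>Im\<close>: both parts of the complex eigenvector satisfy the real equations, and one of
    them is nonzero.\<close>
  have eig: "(\<Sum>j\<in>verts G. signless_laplacian G i j * h (v $ g j)) = Re k * h (v $ g i)"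
    if h: "\<And>x y. h (x + y) = h x + h y" "\<And>c x. h (complex_of_real c * x) = c * h x"
      and i: "i \<in> verts G" for i and h :: "complex \<Rightarrow> real"
  proof -
    obtain a where a: "a < n" "i = f a"
      using i bij_betw_imp_surj_on[OF f] by (metis atLeastLessThan_iff imageE)
    have h0: "h 0 = 0" using h(1)[of 0 0] by simp
    have hsum: "h (\<Sum>b\<in>B. c b) = (\<Sum>b\<in>B. h (c b))" for B :: "nat set" and c
      by (induction B rule: infinite_finite_induct) (simp_all add: h0 h)
    have "(\<Sum>j\<in>verts G. signless_laplacian G i j * h (v $ g j))
        = (\<Sum>b\<in>{0..<n}. signless_laplacian G (f a) (f b) * h (v $ g (f b)))"
      unfolding a(2) by (rule sum.reindex_bij_betw[OF f, symmetric])
    also have "\<dots> = (\<Sum>b\<in>{0..<n}. h (complex_of_real (q a b) * v $ b))"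
      by (intro sum.cong) (auto simp: q_def h gf)
    also have "\<dots> = h (\<Sum>b\<in>{0..<n}. complex_of_real (q a b) * v $ b)"
      by (rule hsum[symmetric])
    also have "\<dots> = h (complex_of_real (Re k) * v $ a)" using ev[OF a(1)] k by simp
    also have "\<dots> = Re k * h (v $ g i)" using a gf by (simp add: h)
    finally show ?thesis .
  qed
  have "is_Q_eigenvalue G (Re k)"
  proof (cases "Re (v $ a0) = 0")
    case False
    then show ?thesis unfolding is_Q_eigenvalue_def
      using eig[of Re] a0 gf f
      by (intro exI[of _ "\<lambda>j. Re (v $ g j)"]) (auto simp: bij_betw_def intro!: bexI[of _ "f a0"])
  next
    case True
    then have "Im (v $ a0) \<noteq> 0" using a0 by (simp add: complex_eq_iff)
    then show ?thesis unfolding is_Q_eigenvalue_def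
      using eig[of Im] a0 gf f
      by (intro exI[of _ "\<lambda>j. Im (v $ g j)"]) (auto simp: bij_betw_def intro!: bexI[of _ "f a0"])
  qed
  then show "{x. is_Q_eigenvalue G x} \<noteq> {}" by blast
qed

lemma is_Q_eigenvalue_q_index:
  assumes "simple_graph G" "verts G \<noteq> {}"
  shows "is_Q_eigenvalue G (q_index G)"
  using Max_in[OF Q_eigenvalues_finite_nonempty[OF assms]] by (simp add: q_index_def)

text \<open>Compare an arbitrary eigenvector \<open>w\<close> with \<open>y\<close> at a vertex maximising \<open>\<bar>w i\<bar> / y i\<close>.\<close>
lemma q_index_positive_eigenvector:
  fixes G :: "'a graph"
  assumes G: "simple_graph G" and ne: "verts G \<noteq> {}"
    and pos: "\<And>i. i \<in> verts G \<Longrightarrow> y i > 0"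
    and y: "\<And>i. i \<in> verts G \<Longrightarrow> real (degree G i) * y i + (\<Sum>j\<in>nbrs G i. y j) = \<rho> * y i"
  shows "q_index G = \<rho>"
proof -
  have "is_Q_eigenvalue G \<rho>"
    unfolding is_Q_eigenvalue_iff[OF G] using ne pos y by (intro exI[of _ y]) force
  moreover have "x \<le> \<rho>" if "is_Q_eigenvalue G x" for x
  proof -
    from that obtain w where W: "(\<exists>i\<in>verts G. w i \<noteq> 0) \<and>
        (\<forall>i\<in>verts G. real (degree G i) * w i + (\<Sum>j\<in>nbrs G i. w j) = x * w i)"
      unfolding is_Q_eigenvalue_iff[OF G] by (rule exE)
    note w0 = W[THEN conjunct1] and w = W[THEN conjunct2, rule_format]
    let ?M = "Max ((\<lambda>i. \<bar>w i\<bar> / y i) ` verts G)"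
    have fin: "finite ((\<lambda>i. \<bar>w i\<bar> / y i) ` verts G)" "(\<lambda>i. \<bar>w i\<bar> / y i) ` verts G \<noteq> {}"
      using finite_verts[OF G] ne by auto
    obtain i where i: "i \<in> verts G" "?M = \<bar>w i\<bar> / y i" using Max_in[OF fin] by auto
    have le: "\<bar>w j\<bar> \<le> ?M * y j" if "j \<in> verts G" for j
      using Max_ge[OF fin(1), of "\<bar>w j\<bar> / y j"] pos[OF that] that by (simp add: divide_le_eq)
    have wi: "\<bar>w i\<bar> = ?M * y i" using i pos[OF i(1)] by simp
    have M: "?M > 0"
    proof -
      obtain j where "j \<in> verts G" "w j \<noteq> 0" using w0 by blast
      then show ?thesis using le[of j] pos[of j] by (smt (verit) mult_nonpos_nonneg)
    qed
    have "x * \<bar>w i\<bar> \<le> \<bar>x * w i\<bar>" by (simp add: abs_mult mult_right_mono)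
    also have "\<dots> \<le> real (degree G i) * \<bar>w i\<bar> + (\<Sum>j\<in>nbrs G i. \<bar>w j\<bar>)"
      unfolding w[OF i(1), symmetric]
      by (rule order_trans[OF abs_triangle_ineq] add_mono)+ (auto simp: abs_mult)
    also have "\<dots> \<le> real (degree G i) * (?M * y i) + (\<Sum>j\<in>nbrs G i. ?M * y j)"
      using le wi by (intro add_mono sum_mono) (auto simp: nbrs_iff)
    also have "\<dots> = ?M * (real (degree G i) * y i + (\<Sum>j\<in>nbrs G i. y j))"
      by (simp add: sum_distrib_left distrib_left mult.left_commute)
    also have "\<dots> = \<rho> * \<bar>w i\<bar>" unfolding y[OF i(1)] wi by simp
    finally show ?thesis using wi M pos[OF i(1)] by simp
  qed
  ultimately show ?thesis
    unfolding q_index_def using Q_eigenvalues_finite_nonempty[OF G ne] by (intro Max_eqI) auto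
qed

section \<open>Invariance of the index under isomorphism\<close>

lemma is_Q_eigenvalue_iso:
  fixes G :: "'a graph" and H :: "'b graph"
  assumes iso: "graph_iso G H" and x: "is_Q_eigenvalue H x"
  shows "is_Q_eigenvalue G x"
proof -
  obtain f where f: "bij_betw f (verts G) (verts H)"
    and E: "\<And>u v. u \<in> verts G \<Longrightarrow> v \<in> verts G \<Longrightarrow> {u, v} \<in> edges G \<longleftrightarrow> {f u, f v} \<in> edges H"
    using iso unfolding graph_iso_def by blast
  have deg: "degree H (f i) = degree G i" if "i \<in> verts G" for i
  proof -
    have "{u \<in> verts H. {u, f i} \<in> edges H} = f ` {u \<in> verts G. {u, i} \<in> edges G}"
      using f E[OF _ that] that unfolding bij_betw_def by fastforce
    moreover have "inj_on f {u \<in> verts G. {u, i} \<in> edges G}"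
      using f by (auto simp: bij_betw_def inj_on_def)
    ultimately show ?thesis unfolding degree_def by (simp add: card_image)
  qed
  have Q: "signless_laplacian H (f i) (f j) = signless_laplacian G i j" if "i \<in> verts G" "j \<in> verts G" for i j
    using that deg E f unfolding signless_laplacian_def
    by (auto simp: bij_betw_def inj_on_eq_iff)
  obtain w where w0: "\<exists>i\<in>verts H. w i \<noteq> 0"
    and w: "\<And>i. i \<in> verts H \<Longrightarrow> (\<Sum>j\<in>verts H. signless_laplacian H i j * w j) = x * w i"
    using x unfolding is_Q_eigenvalue_def by blast
  have "(\<Sum>j\<in>verts G. signless_laplacian G i j * w (f j)) = x * w (f i)" if i: "i \<in> verts G" for i
  proof -
    have "(\<Sum>j\<in>verts G. signless_laplacian G i j * w (f j)) = (\<Sum>j\<in>verts G. signless_laplacian H (f i) (f j) * w (f j))"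
      using i Q by (intro sum.cong) auto
    also have "\<dots> = (\<Sum>j\<in>verts H. signless_laplacian H (f i) j * w j)"
      by (rule sum.reindex_bij_betw[OF f])
    also have "\<dots> = x * w (f i)" using w f i by (auto simp: bij_betw_def)
    finally show ?thesis .
  qed
  moreover have "\<exists>i\<in>verts G. w (f i) \<noteq> 0" 
    using w0 bij_betw_imp_surj_on[OF f] by (metis imageE)
  ultimately show ?thesis unfolding is_Q_eigenvalue_def by (intro exI[of _ "\<lambda>i. w (f i)"]) simp
qed

lemma graph_iso_sym:
  fixes G :: "'a graph" and H :: "'b graph"
  assumes "graph_iso G H"
  shows "graph_iso H G"
proof -
  obtain f where f: "bij_betw f (verts G) (verts H)"
    and E: "\<And>u v. u \<in> verts G \<Longrightarrow> v \<in> verts G \<Longrightarrow> {u, v} \<in> edges G \<longleftrightarrow> {f u, f v} \<in> edges H"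
    using assms unfolding graph_iso_def by blast
  let ?g = "inv_into (verts G) f"
  have g: "bij_betw ?g (verts H) (verts G)" by (rule bij_betw_inv_into[OF f])
  have "f (?g u) = u" "?g u \<in> verts G" if "u \<in> verts H" for u
    using that f g by (auto simp: bij_betw_inv_into_right bij_betw_def)
  then show ?thesis unfolding graph_iso_def
    using g E by (intro exI[of _ ?g]) (metis (no_types, lifting))
qed

lemma q_index_iso:
  assumes "graph_iso G H"
  shows "q_index G = q_index H"
  unfolding q_index_def
  using is_Q_eigenvalue_iso[OF assms] is_Q_eigenvalue_iso[OF graph_iso_sym[OF assms]] by metis

section \<open>Two dominating vertices\<close>

lemma degree_le_card_minus:
  assumes "simple_graph G"
  shows "degree G a \<le> card (verts G - {a})"
  unfolding degree_nbrs using assms no_loop[OF assms]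
  by (intro card_mono) (auto simp: nbrs_iff finite_verts)

text \<open>Inclusion-exclusion applied twice writes |A| + |B| + |C| as the sum of the sizes of A
  \<union> B, (A \<inter> B) \<union> C and A \<inter> B \<inter> C. The first two are at most the
  order, and the third is at most 2.\<close>

lemma sum_three_degrees_le:
  assumes G: "simple_graph G" and K: "\<not> has_minor G (complete_bipartite 3 3)"
    and abc: "a \<in> verts G" "b \<in> verts G" "c \<in> verts G" "a \<noteq> b" "a \<noteq> c" "b \<noteq> c"
  shows "degree G a + degree G b + degree G c \<le> 2 * card (verts G) + 2"
proof -
  let ?A = "nbrs G a" and ?B = "nbrs G b" and ?C = "nbrs G c"
  note fin = finite_nbrs[OF G]
  have le: "card U \<le> card (verts G)" if "U \<subseteq> verts G" for U
    using that finite_verts[OF G] by (rule card_mono[rotated])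
  have "card (?A \<inter> ?B \<inter> ?C) \<le> 2"
  proof (rule ccontr)
    assume "\<not> ?thesis"
    then have "3 \<le> card (?A \<inter> ?B \<inter> ?C)" by simp
    from obtain_subset_with_card_n[OF this] obtain S where S: "S \<subseteq> ?A \<inter> ?B \<inter> ?C" "card S = 3" by blast
    have "has_minor G (complete_bipartite 3 3)"
    proof (rule K33_subgraph_has_minor[OF G _ S(2)])
      show "card {a, b, c} = 3" using abc by simp
      show "{a, b, c} \<inter> S = {}" using S(1) not_nbrs_self[OF G] by auto
    qed (use S(1) abc in \<open>auto simp: nbrs_iff subset_eq\<close>)
    with K show False by simp
  qed
  moreover have "card ?A + card ?B = card (?A \<union> ?B) + card (?A \<inter> ?B)"
    by (rule card_Un_Int[OF fin fin])
  moreover have "card (?A \<inter> ?B) + card ?C = card (?A \<inter> ?B \<union> ?C) + card (?A \<inter> ?B \<inter> ?C)"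
    by (rule card_Un_Int) (use fin in auto)
  moreover have "card (?A \<union> ?B) \<le> card (verts G)" "card (?A \<inter> ?B \<union> ?C) \<le> card (verts G)"
    by (rule le; auto simp: nbrs_iff)+
  ultimately show ?thesis unfolding degree_nbrs by linarith
qed

text \<open>The scaling \<open>x u = 1\<close> turns the row at \<open>u\<close> into a lower bound
  on \<open>degree G u\<close>. Absolute values cost the equality, but the inequality also holds
  where \<open>\<mu>\<close> is below the degree, since the left side is then nonpositive.\<close>

lemma Q_eigenvector_normalized:
  fixes G :: "'a graph"
  assumes G: "simple_graph G" and x: "is_Q_eigenvalue G \<mu>"
  obtains x u where "u \<in> verts G" "x u = (1::real)" "\<And>i. 0 \<le> x i" "\<And>i. i \<in> verts G \<Longrightarrow> x i \<le> 1"
    "\<And>i. i \<in> verts G \<Longrightarrow> (\<mu> - real (degree G i)) * x i \<le> (\<Sum>j\<in>nbrs G i. x j)"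
proof -
  from x obtain w where W: "(\<exists>i\<in>verts G. w i \<noteq> 0) \<and>
      (\<forall>i\<in>verts G. real (degree G i) * w i + (\<Sum>j\<in>nbrs G i. w j) = \<mu> * w i)"
    unfolding is_Q_eigenvalue_iff[OF G] by (rule exE)
  note w = W[THEN conjunct2, rule_format]
  obtain i0 where i0: "i0 \<in> verts G" "w i0 \<noteq> 0" using W by blast
  let ?M = "Max ((\<lambda>i. \<bar>w i\<bar>) ` verts G)"
  have fin: "finite ((\<lambda>i. \<bar>w i\<bar>) ` verts G)" "(\<lambda>i. \<bar>w i\<bar>) ` verts G \<noteq> {}"
    using finite_verts[OF G] i0 by auto
  obtain u where u: "u \<in> verts G" "?M = \<bar>w u\<bar>" using Max_in[OF fin] by auto
  have le: "\<bar>w i\<bar> \<le> \<bar>w u\<bar>" if "i \<in> verts G" for i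
    using Max_ge[OF fin(1), of "\<bar>w i\<bar>"] that u(2) by simp
  have pos: "\<bar>w u\<bar> > 0" using le[OF i0(1)] i0(2) by linarith
  have "(\<mu> - real (degree G i)) * \<bar>w i\<bar> \<le> (\<Sum>j\<in>nbrs G i. \<bar>w j\<bar>)" if "i \<in> verts G" for i
  proof -
    have "(\<mu> - real (degree G i)) * \<bar>w i\<bar> \<le> \<bar>(\<mu> - real (degree G i)) * w i\<bar>"
      by (simp add: abs_mult mult_right_mono)
    also have "(\<mu> - real (degree G i)) * w i = (\<Sum>j\<in>nbrs G i. w j)"
      using w[OF that] by (simp add: algebra_simps)
    also have "\<bar>\<dots>\<bar> \<le> (\<Sum>j\<in>nbrs G i. \<bar>w j\<bar>)" by (rule sum_abs)
    finally show ?thesis .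
  qed
  then have "(\<mu> - real (degree G i)) * (\<bar>w i\<bar> / \<bar>w u\<bar>) \<le> (\<Sum>j\<in>nbrs G i. \<bar>w j\<bar> / \<bar>w u\<bar>)"
    if "i \<in> verts G" for i
    using divide_right_mono[of _ _ "\<bar>w u\<bar>"] pos that by (fastforce simp: sum_divide_distrib)
  then show ?thesis
    using that[of u "\<lambda>i. \<bar>w i\<bar> / \<bar>w u\<bar>"] u le pos by simp
qed

text \<open>At the maximal entry \<open>u\<close> the row reads \<open>\<mu> - d u\<close> \<le> sum
  of \<open>x\<close> over the neighbours, so a bound on the total \<open>T\<close> bounds how far
  \<open>u\<close> is from dominating. Conversely, a large \<open>d u\<close> keeps the degrees in
  \<open>R\<close> near N/2 or less, which makes the entries there small and improves the bound on
  \<open>T\<close>.\<close>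

lemma large_Q_eigenvalue_dominating_pair:
  fixes G :: "'a graph"
  assumes G: "simple_graph G" and n: "card (verts G) = n" "n \<ge> 1186"
    and K: "\<not> has_minor G (complete_bipartite 3 3)"
    and ev: "is_Q_eigenvalue G \<mu>" and big: "\<mu> > real n + 2"
  obtains u v where "u \<in> verts G" "v \<in> verts G" "u \<noteq> v"
    "nbrs G u = verts G - {u}" "nbrs G v = verts G - {v}"
proof -
  let ?V = "verts G"
  define N where "N = real n"
  define d where "d i = real (degree G i)" for i
  have N: "N \<ge> 1186" "\<mu> > N + 2" using n big by (simp_all add: N_def)
  obtain x u where u: "u \<in> ?V" "x u = 1" and x0: "\<And>i. 0 \<le> x i" and x1: "\<And>i. i \<in> ?V \<Longrightarrow> x i \<le> 1"
    and row: "\<And>i. i \<in> ?V \<Longrightarrow> (\<mu> - d i) * x i \<le> (\<Sum>j\<in>nbrs G i. x j)"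
    unfolding d_def by (rule Q_eigenvector_normalized[OF G ev]) blast
  have fV: "finite ?V" by (rule finite_verts[OF G])
  have d0: "0 \<le> d i" for i by (simp add: d_def)
  have dN: "d i \<le> N - 1" if "i \<in> ?V" for i
    using degree_le_card_minus[OF G, of i] that fV n unfolding d_def N_def by simp
  have "(\<Sum>i\<in>?V. degree G i) < 12 * n" using sum_degree_less[OF G _ K] u(1) n(1) by auto
  then have "real (\<Sum>i\<in>?V. degree G i) < real (12 * n)" by (simp only: of_nat_less_iff)
  then have dsum: "(\<Sum>i\<in>?V. d i) \<le> 12 * N" by (simp add: d_def N_def)
  have three: "d a + d b + d c \<le> 2 * N + 2"
    if "a \<in> ?V" "b \<in> ?V" "c \<in> ?V" "a \<noteq> b" "a \<noteq> c" "b \<noteq> c" for a b c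
  proof -
    have "real (degree G a + degree G b + degree G c) \<le> real (2 * n + 2)"
      using sum_three_degrees_le[OF G K that] n(1) by (simp only: of_nat_le_iff)
    then show ?thesis by (simp add: d_def N_def)
  qed
  define T where "T = (\<Sum>i\<in>?V. x i)"
  have nbrs_le: "(\<Sum>j\<in>nbrs G i. x j) \<le> (\<Sum>j\<in>U. x j)" if "nbrs G i \<subseteq> U" "U \<subseteq> ?V" for i U
    using that fV x0 by (intro sum_mono2) (auto intro: finite_subset)
  have nbrsV: "nbrs G i \<subseteq> ?V - {i}" for i using no_loop[OF G] by (auto simp: nbrs_iff)

  \<comment> \<open>Three vertices above this degree would violate \<open>three\<close>, so
    \<open>L\<close> has at most two; the others have \<open>\<mu> - d i\<close> > (N +
    4)/3.\<close>
  define L where "L = {i \<in> ?V. 3 * d i > 2 * N + 2}"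
  have LV: "L \<subseteq> ?V" by (auto simp: L_def)
  have cL: "card L \<le> 2"
  proof (rule ccontr)
    assume "\<not> ?thesis"
    then have "3 \<le> card L" by simp
    from obtain_subset_with_card_n[OF this] obtain S where S: "S \<subseteq> L" "card S = 3" by blast
    then obtain a b c where "S = {a, b, c}" "a \<noteq> b" "a \<noteq> c" "b \<noteq> c" by (auto simp: card_3_iff)
    then show False using three[of a b c] S(1) by (simp add: L_def)
  qed
  have xL: "x i \<le> 3 * d i / (N + 4)" if "i \<in> ?V - L" for i
  proof -
    have "(N + 4) / 3 * x i \<le> (\<mu> - d i) * x i"
      using that N x0 by (intro mult_right_mono) (auto simp: L_def)
    also have "\<dots> \<le> (\<Sum>j\<in>nbrs G i. x j)" using row that by simp
    also have "\<dots> \<le> (\<Sum>j\<in>nbrs G i. 1)" by (intro sum_mono x1) (auto simp: nbrs_iff)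
    also have "\<dots> = d i" by (simp add: d_def degree_nbrs)
    finally show ?thesis using N by (simp add: field_simps)
  qed
  have T38: "T \<le> 38"
  proof -
    have "T = (\<Sum>i\<in>?V - L. x i) + (\<Sum>i\<in>L. x i)"
      unfolding T_def by (rule sum.subset_diff[OF LV fV])
    also have "(\<Sum>i\<in>L. x i) \<le> (\<Sum>i\<in>L. 1)" using LV by (intro sum_mono x1) auto
    also have "\<dots> \<le> 2" using cL by simp
    also have "(\<Sum>i\<in>?V - L. x i) \<le> (\<Sum>i\<in>?V - L. 3 * d i / (N + 4))" by (rule sum_mono[OF xL])
    also have "\<dots> \<le> (\<Sum>i\<in>?V. 3 * d i / (N + 4))" using fV d0 N by (intro sum_mono2) auto
    also have "\<dots> = 3 * (\<Sum>i\<in>?V. d i) / (N + 4)" by (simp add: sum_divide_distrib sum_distrib_left)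
    also have "\<dots> \<le> 3 * (12 * N) / (N + 4)" using dsum N by (intro divide_right_mono) auto
    also have "\<dots> \<le> 36" using N by (simp add: field_simps)
    finally show ?thesis by simp
  qed
  have Tu: "(\<Sum>j\<in>?V - {u}. x j) = T - 1" unfolding T_def using sum.remove[OF fV u(1), of x] u(2) by simp
  \<comment> \<open>The row at \<open>u\<close> gives \<open>\<mu> - d u\<close> \<le> T - 1 \<le>
    37.\<close>
  have du: "d u > N - 35"
    using row[OF u(1)] nbrs_le[OF nbrsV[of u]] Tu T38 u(2) N by auto
  have "card (?V - {u}) \<noteq> 0" using n u(1) fV by simp
  then have "?V - {u} \<noteq> {}" by (metis card.empty)
  then obtain v where v: "v \<in> ?V - {u}" and vmax: "\<And>w. w \<in> ?V - {u} \<Longrightarrow> d w \<le> d v"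
    using fV obtains_MAX[of "?V - {u}" d] by (metis (no_types, lifting) Max_ge finite_Diff finite_imageI imageI)
  define R where "R = ?V - {u, v}"
  have R: "finite R" "R \<subseteq> ?V" "u \<notin> R" "v \<notin> R" using fV by (auto simp: R_def)
  have split: "(\<Sum>i\<in>?V. f i) = f u + f v + (\<Sum>i\<in>R. f i)" for f :: "'a \<Rightarrow> real"
  proof -
    have "?V = insert u (insert v R)" using u v by (auto simp: R_def)
    then show ?thesis using R v by auto
  qed
  define S where "S = (\<Sum>i\<in>R. x i)"
  have TS: "T = 1 + x v + S" unfolding T_def S_def using split[of x] u by simp
  have xv: "0 \<le> x v" "x v \<le> 1" using x0 x1 v by auto
  \<comment> \<open>As \<open>v\<close> has the largest degree besides \<open>u\<close>, 2 d(w)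
    \<le> d(v) + d(w) \<le> 2N + 2 - d(u).\<close>
  have dR: "2 * d w \<le> N + 37" if "w \<in> R" for w
    using three[of u v w] vmax[of w] du that u v by (auto simp: R_def)
  text \<open>Here \<open>24.7 \<ge> 24 N / (N - 33)\<close> and below \<open>0.0416 \<ge> 49.4 / 1188\<close>.\<close>
  have S_step: "\<mu> * S \<le> 49.4 * B + d u + d v * x v" if B: "T \<le> B" for B
  proof -
    have "0 \<le> T" unfolding T_def by (intro sum_nonneg x0)
    have xw: "x w \<le> 2 * B / (N - 33)" if w: "w \<in> R" for w
    proof -
      have "(N - 33) / 2 * x w \<le> (\<mu> - d w) * x w"
        using dR[OF w] N x0 by (intro mult_right_mono) auto
      also have "\<dots> \<le> (\<Sum>j\<in>nbrs G w. x j)" using row w R by auto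
      also have "\<dots> \<le> T" unfolding T_def using nbrs_le[of w ?V] nbrsV[of w] by auto
      finally show ?thesis using N B by (simp add: field_simps)
    qed
    have "(\<Sum>w\<in>R. d w * x w) \<le> (\<Sum>w\<in>R. d w * (2 * B / (N - 33)))"
      using xw d0 by (intro sum_mono mult_left_mono) auto
    also have "\<dots> = (\<Sum>w\<in>R. d w) * (2 * B / (N - 33))" by (rule sum_distrib_right[symmetric])
    also have "\<dots> \<le> 12 * N * (2 * B / (N - 33))"
      using split[of d] d0[of u] d0[of v] dsum N B \<open>0 \<le> T\<close> by (intro mult_right_mono) auto
    also have "\<dots> = B * (24 * N / (N - 33))" by simp
    also have "\<dots> \<le> B * 24.7" using N B \<open>0 \<le> T\<close> by (intro mult_left_mono) (auto simp: field_simps)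
    finally have D: "(\<Sum>w\<in>R. d w * x w) \<le> 24.7 * B" by simp
    have "(\<Sum>w\<in>R. \<Sum>j\<in>nbrs G w. x j) = (\<Sum>w\<in>R. \<Sum>j\<in>?V. if j \<in> nbrs G w then x j else 0)"
    proof (rule sum.cong)
      fix w
      have "nbrs G w = ?V \<inter> nbrs G w" by (auto simp: nbrs_iff)
      then show "(\<Sum>j\<in>nbrs G w. x j) = (\<Sum>j\<in>?V. if j \<in> nbrs G w then x j else 0)"
        using sum.inter_restrict[OF fV, of x "nbrs G w"] by simp
    qed simp
    \<comment> \<open>After the swap \<open>x j\<close> is counted once for each neighbour of
      \<open>j\<close> in \<open>R\<close>, at most \<open>d j\<close> times.\<close>
    also have "\<dots> = (\<Sum>j\<in>?V. \<Sum>w\<in>R. if j \<in> nbrs G w then x j else 0)" by (rule sum.swap)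
    also have "\<dots> \<le> (\<Sum>j\<in>?V. d j * x j)"
    proof (rule sum_mono)
      fix j
      have "(\<Sum>w\<in>R. if j \<in> nbrs G w then x j else 0) = (\<Sum>w\<in>R \<inter> nbrs G j. x j)"
        using sum.inter_restrict[OF R(1), of "\<lambda>_. x j" "nbrs G j"] nbrs_sym[OF G, of j] by simp
      also have "\<dots> \<le> (\<Sum>w\<in>nbrs G j. x j)" using finite_nbrs[OF G] x0 by (intro sum_mono2) auto
      finally show "(\<Sum>w\<in>R. if j \<in> nbrs G w then x j else 0) \<le> d j * x j"
        by (simp add: d_def degree_nbrs)
    qed
    also have "\<dots> = d u + d v * x v + (\<Sum>w\<in>R. d w * x w)" using split[of "\<lambda>j. d j * x j"] u by simp
    finally have "(\<Sum>w\<in>R. \<Sum>j\<in>nbrs G w. x j) \<le> d u + d v * x v + 24.7 * B" using D by simp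
    moreover have "(\<Sum>w\<in>R. (\<mu> - d w) * x w) \<le> (\<Sum>w\<in>R. \<Sum>j\<in>nbrs G w. x j)"
      using R by (intro sum_mono row) auto
    moreover have "(\<Sum>w\<in>R. (\<mu> - d w) * x w) = \<mu> * S - (\<Sum>w\<in>R. d w * x w)"
      unfolding S_def by (simp add: sum_distrib_left sum_subtractf left_diff_distrib)
    ultimately show ?thesis using D by simp
  qed
  have dvx: "d v * x v \<le> \<mu> * x v" "d u \<le> \<mu>"
    using dN[of u] dN[of v] u v N x0 by (auto intro!: mult_right_mono)
  have dvx': "\<mu> * x v \<le> \<mu>" using N xv by (simp add: mult_left_le)
  have S_le: "S \<le> 1 + x v + B * 0.0416" if "T \<le> B" "0 \<le> B" for B
  proof -
    have "49.4 * B \<le> \<mu> * (B * 0.0416)" using N that mult_right_mono[of 1188 \<mu> "B * 0.0416"] by simp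
    then have "\<mu> * S \<le> \<mu> * (1 + x v + B * 0.0416)"
      unfolding distrib_left mult_1_right using S_step[OF that(1)] dvx by linarith
    then show ?thesis using N by simp
  qed
  \<comment> \<open>From \<open>TS\<close> and \<open>S_le\<close>, T \<le> 2 + 2 x(v) + 0.0416 B
    \<le> 4 + 0.0416 B: B = 38 gives 5.58 and B = 5.6 gives 4.23. Finally 0.0416 * 4.24 <
    0.18.\<close>
  have "T \<le> 5.6" using S_le[OF T38] TS xv by simp
  then have "T \<le> 4.24" using S_le[of "5.6"] TS xv by simp
  then have S3: "S \<le> 1 + x v + 0.18" using S_le[of "4.24"] by simp
  have nbrs_u: "(\<Sum>j\<in>nbrs G u. x j) \<le> S + x v"
    using nbrs_le[OF nbrsV[of u]] Tu TS by simp
  \<comment> \<open>The gap \<open>\<mu> - d u\<close> is at most \<open>S + x v\<close> \<le> 3.18,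
    so d(u) > N - 1.18; being an integer it equals N - 1.\<close>
  have "d u > N - 2" using row[OF u(1)] u(2) nbrs_u S3 xv N by simp
  then have du1: "degree G u = card (?V - {u})"
    using dN[OF u(1)] u(1) fV n unfolding d_def N_def by simp
  then have domu: "nbrs G u = ?V - {u}"
    unfolding degree_nbrs using nbrsV[of u] fV by (intro card_subset_eq) auto
  have "\<mu> - d u \<le> S + x v" using row[OF u(1)] u(2) nbrs_u by simp
  \<comment> \<open>Since \<open>d u\<close> \<le> N - 1, the gap exceeds 3, whence 3 < 1.18 + 2
    x(v).\<close>
  then have xv9: "x v \<ge> 0.91" using S3 dN[OF u(1)] N by simp
  have "(\<mu> - d v) * x v \<le> 1 + S"
  proof -
    have "(\<mu> - d v) * x v \<le> (\<Sum>j\<in>nbrs G v. x j)" using row v by simp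
    also have "\<dots> \<le> (\<Sum>j\<in>?V - {v}. x j)" by (rule nbrs_le[OF nbrsV]) auto
    also have "\<dots> = 1 + S" using sum.remove[OF fV, of v x] v TS unfolding T_def by simp
    finally show ?thesis .
  qed
  \<comment> \<open>A non-dominating \<open>v\<close> has gap above 4, and 4 * 0.91 = 3.64 exceeds
    the available 1 + S \<le> 3.18.\<close>
  moreover have "4 * 0.91 \<le> (\<mu> - d v) * x v" if "d v \<le> N - 2"
    using that N xv9 by (intro mult_mono) auto
  ultimately have "d v > N - 2" using S3 xv by (cases "d v \<le> N - 2") auto
  then have "degree G v = card (?V - {v})"
    using dN[of v] v fV n unfolding d_def N_def by simp
  then have "nbrs G v = ?V - {v}"
    unfolding degree_nbrs using nbrsV[of v] fV by (intro card_subset_eq) auto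
  with domu u v that show ?thesis by blast
qed

section \<open>The rest of the graph\<close>

lemma card_2_other:
  assumes "card X = 2" "x \<in> X"
  obtains y where "X = {x, y}" "y \<noteq> x"
proof -
  obtain p q where "X = {p, q}" "p \<noteq> q" using assms(1) unfolding card_2_iff by (elim exE conjE)
  then show ?thesis using assms(2) that[of p] that[of q] by (auto simp: insert_commute)
qed

lemma card_2_eq: "card X = 2 \<Longrightarrow> x \<in> X \<Longrightarrow> y \<in> X \<Longrightarrow> x \<noteq> y \<Longrightarrow> X = {x, y}"
  by (erule (1) card_2_other) simp

text \<open>A path \<open>a, w, b\<close> in a 2-regular part lies on a cycle; contracting the cycle to length four
  and adding the two dominating vertices to opposite sides yields \<open>K\<^sub>3\<^sub>,\<^sub>3\<close>.\<close>
lemma long_cycle_K33_minor: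
  fixes G :: "'a graph"
  assumes uv: "u \<noteq> v"
  assumes "simple_graph G" "u \<in> verts G" "v \<in> verts G"
    "nbrs G u = verts G - {u}" "nbrs G v = verts G - {v}"
    "T \<subseteq> verts G - {u, v}"
    "\<And>t. t \<in> T \<Longrightarrow> nbrs G t - {u, v} \<subseteq> T" "\<And>t. t \<in> T \<Longrightarrow> card (nbrs G t - {u, v}) = 2"
    "w \<in> T" "nbrs G w - {u, v} = {a, b}" "a \<noteq> b" "b \<notin> nbrs G a"
  shows "has_minor G (complete_bipartite 3 3)"
  using assms(2-)
proof (induction "card (verts G)" arbitrary: G T rule: less_induct)
  case less
  note G = less.prems(1) and domu = less.prems(4) and domv = less.prems(5) and TV = less.prems(6)
    and clT = less.prems(7) and cT = less.prems(8) and wT = less.prems(9) and hw = less.prems(10)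
    and ab = less.prems(11) and nab = less.prems(12)
  note sym = nbrs_sym[OF G] and irr = not_nbrs_self[OF G]
  have abT: "a \<in> T" "b \<in> T" using clT[OF wT] hw by auto
  have wuv: "w \<noteq> u" "w \<noteq> v" using wT TV by auto
  have "w \<in> nbrs G a - {u, v}" using hw sym[of w a] wuv by blast
  then obtain a' where ha: "nbrs G a - {u, v} = {w, a'}" "a' \<noteq> w"
    by (rule card_2_other[OF cT[OF abT(1)]])
  have a'T: "a' \<in> T" using clT[OF abT(1)] ha by auto
  have na: "a' \<in> nbrs G a" "a \<in> nbrs G a'" using ha sym[of a' a] by blast+
  have ne: "a' \<noteq> a" "a' \<noteq> b" "w \<noteq> a" "w \<noteq> b" using na nab irr hw by blast+
  have Vs: "w \<in> verts G" "a \<in> verts G" "b \<in> verts G" "a' \<in> verts G" using wT abT a'T TV by auto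
  have nuv: "a \<noteq> u" "a \<noteq> v" "b \<noteq> u" "b \<noteq> v" "a' \<noteq> u" "a' \<noteq> v" using abT a'T TV by auto
  show ?case
  proof (cases "b \<in> nbrs G a'")
    case True
    \<comment> \<open>Here w, a, a', b is a four-cycle; its opposite pairs, extended by
      \<open>u\<close> and \<open>v\<close>, are the two sides.\<close>
    have E: "{p, q} \<in> edges G" if "q \<in> nbrs G p" for p q using that by (simp add: nbrs_iff)
    have "a \<in> nbrs G w" "b \<in> nbrs G w" using hw by blast+
    moreover have "v \<in> nbrs G w" "v \<in> nbrs G a'"
      using sym[of v w] sym[of v a'] domv Vs wuv nuv by auto
    moreover have "a \<in> nbrs G u" "b \<in> nbrs G u" "v \<in> nbrs G u"
      using domu Vs nuv uv less.prems(3) by auto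
    ultimately have "\<And>p q. p \<in> {w, a', u} \<Longrightarrow> q \<in> {a, b, v} \<Longrightarrow> {p, q} \<in> edges G"
      using na True E by blast
    moreover have "card {w, a', u} = 3" "card {a, b, v} = 3" "{w, a', u} \<inter> {a, b, v} = {}"
      using ha(2) wuv nuv ne ab uv by auto
    ultimately show ?thesis
      using Vs less.prems(2,3) by (intro K33_subgraph_has_minor[OF G, of "{w, a', u}" "{a, b, v}"]) auto
  next
    case False
    have "a \<in> nbrs G a' - {u, v}" using na nuv by auto
    then obtain c where ha': "nbrs G a' - {u, v} = {a, c}" "c \<noteq> a"
      by (rule card_2_other[OF cT[OF a'T]])
    have ca': "c \<in> nbrs G a'" "a' \<in> nbrs G c" "c \<noteq> a'" using ha' sym[of c a'] irr by blast+
    have "a' \<notin> nbrs G w" using hw ne nuv by blast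
    then have cw: "c \<noteq> w" using ca' by auto
    have cT': "c \<in> T" using clT[OF a'T] ha' by auto
    \<comment> \<open>Contracting into \<open>a\<close> shortens the cycle by one: \<open>a\<close>
      takes over the other neighbour \<open>c\<close> of \<open>a'\<close>. The neighbours of
      \<open>w\<close> stay \<open>a\<close> and \<open>b\<close>, and these stay non-adjacent
      because \<open>b\<close> is not adjacent to \<open>a'\<close> either.\<close>
    let ?M = "contract_edge G a a'"
    have aa': "{a, a'} \<in> edges G" using na by (simp add: nbrs_iff)
    have M: "simple_graph ?M" by (rule simple_contract[OF G aa'])
    have VM: "verts ?M = verts G - {a'}" by (simp add: verts_contract)
    have nM: "z \<in> nbrs ?M t \<longleftrightarrow> z \<noteq> a' \<and>
        (z \<in> nbrs G t \<or> (t = a \<and> z \<noteq> a \<and> z \<in> nbrs G a') \<or> (z = a \<and> t \<noteq> a \<and> t \<in> nbrs G a'))"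
      if "t \<in> verts G" "t \<noteq> a'" for t z
      using that Vs edges_contract[of t a' z G a] by (auto simp: nbrs_iff VM)
    have domM: "nbrs ?M d = verts ?M - {d}" if d: "nbrs G d = verts G - {d}" "d \<in> {u, v}" for d
    proof (rule Set.set_eqI)
      fix z
      have "d \<in> verts G" "d \<noteq> a'" "d \<noteq> a" using d less.prems(2,3) nuv by auto
      then show "z \<in> nbrs ?M d \<longleftrightarrow> z \<in> verts ?M - {d}"
        using nM[of d z] d(1) Vs by (auto simp: VM)
    qed
    have hMa: "nbrs ?M a - {u, v} = {w, c}"
    proof (rule Set.set_eqI)
      fix z
      have "z \<in> nbrs ?M a - {u, v} \<longleftrightarrow> z \<noteq> a' \<and>
          (z \<in> nbrs G a - {u, v} \<or> z \<noteq> a \<and> z \<in> nbrs G a' - {u, v})"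
        using nM[OF Vs(2) ne(1)[symmetric], of z] by auto
      then show "z \<in> nbrs ?M a - {u, v} \<longleftrightarrow> z \<in> {w, c}"
        unfolding ha ha' using ha(2) ha'(2) ca'(3) ne by auto
    qed
    have cuv: "c \<noteq> u" "c \<noteq> v" using cT' TV by auto
    have anc: "a \<notin> nbrs G c" using sym[of a c] ha ca'(3) cw cuv by blast
    have hMc: "nbrs ?M c - {u, v} = insert a ((nbrs G c - {u, v}) - {a'})"
    proof (rule Set.set_eqI)
      fix z
      have "c \<in> verts G" using cT' TV by auto
      then show "z \<in> nbrs ?M c - {u, v} \<longleftrightarrow> z \<in> insert a ((nbrs G c - {u, v}) - {a'})"
        using nM[of c z] ca' ha'(2) nuv ne by auto
    qed
    have hMt: "nbrs ?M t - {u, v} = nbrs G t - {u, v}" if t: "t \<in> T" "t \<noteq> a" "t \<noteq> c" "t \<noteq> a'" for t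
    proof (rule Set.set_eqI)
      fix z
      have tV: "t \<in> verts G" "t \<notin> {u, v}" using t TV by auto
      then have "t \<notin> nbrs G a'" using ha' t by blast
      then show "z \<in> nbrs ?M t - {u, v} \<longleftrightarrow> z \<in> nbrs G t - {u, v}"
        using nM[OF tV(1) t(4), of z] sym[of a' t] t by auto
    qed
    let ?T = "T - {a'}"
    have cl: "nbrs ?M t - {u, v} \<subseteq> ?T \<and> card (nbrs ?M t - {u, v}) = 2" if t: "t \<in> ?T" for t
    proof -
      consider "t = a" | "t = c" | "t \<noteq> a" "t \<noteq> c" by blast
      then show ?thesis
      proof cases
        case 1
        then show ?thesis unfolding 1 hMa using wT cT' ha(2) ca'(3) cw by auto
      next
        case 2
        have "a' \<in> nbrs G c - {u, v}" using ca' nuv by auto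
        moreover have "card (nbrs G c - {u, v}) = 2" by (rule cT[OF cT'])
        ultimately have "card ((nbrs G c - {u, v}) - {a'}) = 1" by simp
        then have "card (insert a ((nbrs G c - {u, v}) - {a'})) = 2"
          using anc finite_nbrs[OF G, of c] by simp
        then show ?thesis unfolding 2 hMc using clT[OF cT'] abT ne by auto
      next
        case 3
        have t': "t \<in> T" "t \<noteq> a'" using t by auto
        have "t \<notin> nbrs G a'" using ha' 3 t' TV by blast
        then have "a' \<notin> nbrs G t" using sym by blast
        then show ?thesis unfolding hMt[OF t'(1) 3 t'(2)] using clT[OF t'(1)] cT[OF t'(1)] by auto
      qed
    qed
    have hMw: "nbrs ?M w - {u, v} = {a, b}"
      using hMt[OF wT] ne(3) cw ha(2) hw by auto
    have nabM: "b \<notin> nbrs ?M a" using nM[OF Vs(2) ne(1)[symmetric], of b] nab False by auto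
    have "has_minor ?M (complete_bipartite 3 3)"
    proof (rule less.hyps[of ?M ?T])
      show "card (verts ?M) < card (verts G)"
        unfolding VM using Vs finite_verts[OF G] by (rule_tac card_Diff1_less)
      show "u \<in> verts ?M" "v \<in> verts ?M" using less.prems(2,3) nuv by (auto simp: VM)
      show "nbrs ?M u = verts ?M - {u}" "nbrs ?M v = verts ?M - {v}"
        using domM domu domv by auto
      show "?T \<subseteq> verts ?M - {u, v}" using TV by (auto simp: VM)
      show "w \<in> ?T" using wT ha(2) by auto
    qed (use cl M hMw ab nabM in auto)
    moreover have "minor_of ?M G" using aa' ne by (intro minor_of.contract minor_of.refl) auto
    ultimately show ?thesis using has_minor_minor by metis
  qed
qed

text \<open>One triangle at a time is removed and receives the next three numbers, so that triangles
  become the classes of \<open>div 3\<close>, the grouping in \<open>F33\<close>. The neighbourhood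
  map \<open>h\<close> stays fixed while \<open>T\<close> shrinks, so no graph has to be rebuilt in
  the induction.\<close>

lemma disjoint_triangles_enumeration:
  fixes T :: "'a set"
  assumes "finite T" "\<And>t. t \<in> T \<Longrightarrow> h t \<subseteq> T \<and> card (h t) = 2 \<and> t \<notin> h t"
    "\<And>s t. s \<in> T \<Longrightarrow> t \<in> T \<Longrightarrow> s \<in> h t \<Longrightarrow> t \<in> h s"
    "\<And>t a b. t \<in> T \<Longrightarrow> a \<in> h t \<Longrightarrow> b \<in> h t \<Longrightarrow> a \<noteq> b \<Longrightarrow> b \<in> h a"
  shows "\<exists>p g. bij_betw g T {..<3 * p :: nat} \<and>
    (\<forall>s\<in>T. \<forall>t\<in>T. s \<noteq> t \<longrightarrow> (t \<in> h s \<longleftrightarrow> g s div 3 = g t div 3))"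
  using assms
proof (induction "card T" arbitrary: T rule: less_induct)
  case less
  show ?case
  proof (cases "T = {}")
    case True
    then show ?thesis by (intro exI[of _ 0]) (auto simp: bij_betw_def)
  next
    case False
    then obtain t where t: "t \<in> T" by blast
    then obtain a b where ht: "h t = {a, b}" "a \<noteq> b" using less.prems(2)[OF t] by (auto simp: card_2_iff)
    have abT: "a \<in> T" "b \<in> T" "t \<noteq> a" "t \<noteq> b" using less.prems(2)[OF t] ht by auto
    have ha: "h a = {t, b}"
      using less.prems(2)[OF abT(1)] less.prems(3)[OF abT(1) t] less.prems(4)[OF t, of a b] ht abT
      by (intro card_2_eq) auto
    have hb: "h b = {t, a}"
      using less.prems(2)[OF abT(2)] less.prems(3)[OF abT(2) t] less.prems(4)[OF t, of b a] ht abT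
      by (intro card_2_eq) auto
    let ?T = "T - {t, a, b}"
    \<comment> \<open>The triple is closed under \<open>h\<close>; by symmetry so is its complement,
      and the induction applies.\<close>
    have out: "x \<notin> h s" if "x \<in> {t, a, b}" "s \<in> ?T" for x s
    proof
      assume "x \<in> h s"
      then have "s \<in> h x" using less.prems(3)[of x s] that t abT by auto
      then show False using that ht ha hb by auto
    qed
    have "card ?T < card T" using t less.prems(1) by (intro psubset_card_mono) auto
    moreover have "\<And>s. s \<in> ?T \<Longrightarrow> h s \<subseteq> ?T \<and> card (h s) = 2 \<and> s \<notin> h s"
      using less.prems(2) out by blast
    ultimately have "\<exists>p g. bij_betw g ?T {..<3 * p :: nat} \<and>
        (\<forall>x\<in>?T. \<forall>y\<in>?T. x \<noteq> y \<longrightarrow> (y \<in> h x \<longleftrightarrow> g x div 3 = g y div 3))"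
      using less.prems(1,3,4) by (intro less.hyps) blast+
    then obtain p g where g: "bij_betw g ?T {..<3 * p :: nat}"
      and gh: "\<forall>x\<in>?T. \<forall>y\<in>?T. x \<noteq> y \<longrightarrow> (y \<in> h x \<longleftrightarrow> g x div 3 = g y div 3)"
      by (elim exE conjE)
    define f where "f = g(t := 3 * p, a := 3 * p + 1, b := 3 * p + 2)"
    have fg: "f x = g x" if "x \<in> ?T" for x using that by (auto simp: f_def)
    have fv: "f t = 3 * p" "f a = 3 * p + 1" "f b = 3 * p + 2" using abT ht by (auto simp: f_def)
    have glt: "g x < 3 * p" if "x \<in> ?T" for x using g that by (auto simp: bij_betw_def)
    have "bij_betw f (?T \<union> {t, a, b}) ({..<3 * p} \<union> {3 * p, 3 * p + 1, 3 * p + 2})"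
    proof (rule bij_betw_combine)
      show "bij_betw f ?T {..<3 * p}" using g by (subst bij_betw_cong[OF fg])
      show "bij_betw f {t, a, b} {3 * p, 3 * p + 1, 3 * p + 2}"
        using abT ht by (auto simp: bij_betw_def fv inj_on_def)
    qed auto
    moreover have "?T \<union> {t, a, b} = T" using t abT by auto
    moreover have "{..<3 * p} \<union> {3 * p, 3 * p + 1, 3 * p + 2} = {..<3 * Suc p}" by auto
    ultimately have "bij_betw f T {..<3 * Suc p}" by simp
    moreover have "y \<in> h x \<longleftrightarrow> f x div 3 = f y div 3" if xy: "x \<in> T" "y \<in> T" "x \<noteq> y" for x y
    proof -
      have S: "f z div 3 = p" if "z \<in> {t, a, b}" for z using that fv by auto
      have L: "f z div 3 < p" if "z \<in> ?T" for z using glt[OF that] fg[OF that] by auto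
      consider "x \<in> ?T" "y \<in> ?T" | "x \<in> ?T" "y \<in> {t, a, b}" | "x \<in> {t, a, b}" "y \<in> ?T"
        | "x \<in> {t, a, b}" "y \<in> {t, a, b}" using xy by blast
      then show ?thesis
      proof cases
        case 1
        then show ?thesis using gh xy fg by simp
      next
        case 2
        then show ?thesis using out L[OF 2(1)] S[OF 2(2)] by auto
      next
        case 3
        then have "y \<notin> h x" using ht ha hb by auto
        then show ?thesis using L[OF 3(2)] S[OF 3(1)] by auto
      next
        case 4
        then have "y \<in> h x" using ht ha hb xy(3) by auto
        then show ?thesis using S[OF 4(1)] S[OF 4(2)] by auto
      qed
    qed
    ultimately show ?thesis by blast
  qed
qed

section \<open>Neighbourhoods and eigenvectors relative to a dominating pair\<close>

locale dominating_pair =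
  fixes G :: "'a graph" and u v :: 'a
  assumes simple: "simple_graph G" and uv: "u \<in> verts G" "v \<in> verts G" "u \<noteq> v"
    and dom: "nbrs G u = verts G - {u}" "nbrs G v = verts G - {v}"
begin

definition H :: "'a set" where "H = verts G - {u, v}"
definition h :: "'a \<Rightarrow> 'a set" where "h w = nbrs G w - {u, v}"

lemma finite_H: "finite H"
  by (simp add: H_def finite_verts[OF simple])

lemma finite_h: "finite (h w)"
  by (simp add: h_def finite_nbrs[OF simple])

lemma h_subset: "h w \<subseteq> H"
  by (auto simp: h_def H_def nbrs_iff)

lemma h_irrefl: "w \<notin> h w"
  using not_nbrs_self[OF simple] by (simp add: h_def)

lemma not_h: "u \<notin> h w" "v \<notin> h w"
  by (simp_all add: h_def)

lemma h_sym: "s \<in> H \<Longrightarrow> t \<in> H \<Longrightarrow> s \<in> h t \<longleftrightarrow> t \<in> h s"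
  using nbrs_sym[OF simple] by (auto simp: h_def H_def)

lemma card_H: "card (verts G) = card H + 2"
proof -
  have "verts G = insert u (insert v H)" using uv by (auto simp: H_def)
  moreover have "u \<notin> insert v H" "v \<notin> H" using uv(3) by (auto simp: H_def)
  ultimately show ?thesis using finite_H by simp
qed

lemma sum_verts: "(\<Sum>i\<in>verts G. f i) = f u + f v + (\<Sum>i\<in>H. f i)" for f :: "'a \<Rightarrow> real"
proof -
  have "verts G = insert u (insert v H)" using uv by (auto simp: H_def)
  moreover have "u \<notin> insert v H" "v \<notin> H" using uv(3) by (auto simp: H_def)
  ultimately show ?thesis using finite_H by simp
qed

lemma nbrs_H:
  assumes "w \<in> H"
  shows "nbrs G w = insert u (insert v (h w))"
proof -
  have "w \<in> nbrs G u" "w \<in> nbrs G v" using assms dom by (auto simp: H_def)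
  then have "u \<in> nbrs G w" "v \<in> nbrs G w" using nbrs_sym[OF simple] by blast+
  then show ?thesis by (auto simp: h_def)
qed

lemma sum_nbrs_H: "w \<in> H \<Longrightarrow> (\<Sum>j\<in>nbrs G w. f j) = f u + f v + (\<Sum>j\<in>h w. f j)" for f :: "'a \<Rightarrow> real"
  using uv(3) finite_h[of w] not_h[of w] by (simp add: nbrs_H)

lemma degree_H: "w \<in> H \<Longrightarrow> degree G w = card (h w) + 2"
  using uv(3) finite_h[of w] not_h[of w] by (simp add: degree_nbrs nbrs_H)

lemma sum_nbrs_dom: "(\<Sum>j\<in>nbrs G u. f j) = f v + (\<Sum>j\<in>H. f j)"
    "(\<Sum>j\<in>nbrs G v. f j) = f u + (\<Sum>j\<in>H. f j)" for f :: "'a \<Rightarrow> real"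
  using sum_verts[of f] sum.remove[OF finite_verts[OF simple] uv(1), of f]
    sum.remove[OF finite_verts[OF simple] uv(2), of f] by (simp_all add: dom)

lemma degree_dom: "degree G u = card H + 1" "degree G v = card H + 1"
  using card_H uv finite_verts[OF simple] by (simp_all add: degree_nbrs dom)

lemma sum_h: "(\<Sum>j\<in>h w. f j) = (\<Sum>j\<in>H. if j \<in> h w then f j else 0)" for f :: "'a \<Rightarrow> real"
  using sum.inter_restrict[OF finite_H, of f "h w"] Int_absorb1[OF h_subset[of w]] by simp

text \<open>Double counting of adjacent pairs in \<open>H\<close>; this is what lets the summed rows
  close up in \<open>deficit_identity\<close>.\<close>

lemma sum_sum_h: "(\<Sum>w\<in>H. \<Sum>j\<in>h w. f j) = (\<Sum>j\<in>H. real (card (h j)) * f j)" for f :: "'a \<Rightarrow> real"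
proof -
  have "(\<Sum>w\<in>H. \<Sum>j\<in>h w. f j) = (\<Sum>j\<in>H. \<Sum>w\<in>H. if j \<in> h w then f j else 0)"
    unfolding sum_h by (rule sum.swap)
  also have "\<dots> = (\<Sum>j\<in>H. \<Sum>w\<in>H. if w \<in> h j then f j else 0)"
    using h_sym by (intro sum.cong) auto
  also have "\<dots> = (\<Sum>j\<in>H. real (card (h j)) * f j)"
    using sum_h[of "\<lambda>_. f j" j for j, symmetric] by simp
  finally show ?thesis .
qed

text \<open>Handshake lemma for the graph induced on \<open>H\<close>; it will make the number of
  path ends even.\<close>

lemma even_sum_card_h: "even (\<Sum>w\<in>H. card (h w))"
proof -
  let ?E = "{e \<in> edges G. e \<subseteq> H}"
  have "card (h w) = card {e \<in> ?E. w \<in> e}" if w: "w \<in> H" for w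
  proof -
    have "{e \<in> ?E. w \<in> e} = (\<lambda>z. {w, z}) ` h w"
    proof (intro equalityI subsetI)
      fix e assume "e \<in> {e \<in> ?E. w \<in> e}"
      then have e: "e \<in> edges G" "e \<subseteq> H" "w \<in> e" by auto
      obtain p q where "p \<noteq> q" "e = {p, q}" by (rule simple_edgeE[OF simple e(1)])
      then obtain z where z: "e = {w, z}" using e(3) by (auto simp: insert_commute)
      then have "z \<in> H" using e(2) by simp
      then have "z \<in> h w" using z e(1) by (auto simp: h_def H_def nbrs_iff)
      then show "e \<in> (\<lambda>z. {w, z}) ` h w" using z by blast
    next
      fix e assume "e \<in> (\<lambda>z. {w, z}) ` h w"
      then obtain z where "z \<in> h w" "e = {w, z}" by blast
      then show "e \<in> {e \<in> ?E. w \<in> e}" using w h_subset[of w] by (auto simp: h_def nbrs_iff)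
    qed
    moreover have "inj_on (\<lambda>z. {w, z}) (h w)" by (auto simp: inj_on_def doubleton_eq_iff)
    ultimately show ?thesis by (simp add: card_image)
  qed
  then have "(\<Sum>w\<in>H. card (h w)) = (\<Sum>w\<in>H. card {e \<in> ?E. w \<in> e})" by simp
  also have "\<dots> = 2 * card ?E"
  proof (rule sum_multicount)
    show "\<forall>e\<in>?E. card {w \<in> H. w \<in> e} = 2"
    proof
      fix e assume e: "e \<in> ?E"
      then have "e \<in> edges G" by simp
      then obtain p q where "p \<noteq> q" "e = {p, q}" by (rule simple_edgeE[OF simple])
      moreover have "{w \<in> H. w \<in> e} = e" using e by auto
      ultimately show "card {w \<in> H. w \<in> e} = 2" by simp
    qed
  qed (use finite_H finite_edges[OF simple] in auto)
  finally show ?thesis by simp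
qed

text \<open>A third neighbour in \<open>H\<close> would give \<open>u\<close>, \<open>v\<close>,
  \<open>w\<close> three common neighbours.\<close>

lemma card_h_le_2:
  assumes K: "\<not> has_minor G (complete_bipartite 3 3)" and w: "w \<in> H"
  shows "card (h w) \<le> 2"
proof (rule ccontr)
  assume "\<not> ?thesis"
  then have "3 \<le> card (h w)" by simp
  from obtain_subset_with_card_n[OF this] obtain S where S: "S \<subseteq> h w" "card S = 3" by blast
  have SH: "S \<subseteq> H" "w \<notin> S" using S h_subset h_irrefl by blast+
  have "has_minor G (complete_bipartite 3 3)"
  proof (rule K33_subgraph_has_minor[OF simple _ S(2)])
    show "card {u, v, w} = 3" using uv w by (auto simp: H_def)
    show "{u, v, w} \<inter> S = {}" using SH by (auto simp: H_def)
    show "{u, v, w} \<subseteq> verts G" "S \<subseteq> verts G" using uv w SH by (auto simp: H_def)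
    have "S \<subseteq> nbrs G u" "S \<subseteq> nbrs G v" "S \<subseteq> nbrs G w"
      using SH S dom by (auto simp: H_def h_def)
    then show "{a, b} \<in> edges G" if "a \<in> {u, v, w}" "b \<in> S" for a b
      using that by (auto simp: nbrs_iff)
  qed
  with K show False by simp
qed

text \<open>Subtracting the rows of \<open>u\<close> and \<open>v\<close> shows that their entries
  agree. Since \<open>\<mu>\<close> > 6 and degrees in \<open>H\<close> are at most 2, the rows on
  \<open>H\<close> are strictly diagonally dominant. At an entry of largest modulus this excludes a
  zero entry at \<open>u\<close>; after scaling that entry to 1, the same argument at a smallest
  entry gives positivity. The last equation is the row of \<open>u\<close>.\<close>

lemma Q_eigenvector_H:
  assumes card: "card (verts G) = n" and n: "n \<ge> 4" and h2: "\<And>w. w \<in> H \<Longrightarrow> card (h w) \<le> 2"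
    and ev: "is_Q_eigenvalue G \<mu>" and big: "\<mu> > real n + 2"
  obtains y where "\<And>w. w \<in> H \<Longrightarrow> y w > 0"
    "\<And>w. w \<in> H \<Longrightarrow> (\<mu> - 2 - real (card (h w))) * y w = 2 + (\<Sum>j\<in>h w. y j)"
    "(\<Sum>w\<in>H. y w) = \<mu> - real n"
proof -
  from ev obtain w where W: "(\<exists>i\<in>verts G. w i \<noteq> 0) \<and>
      (\<forall>i\<in>verts G. real (degree G i) * w i + (\<Sum>j\<in>nbrs G i. w j) = \<mu> * w i)"
    unfolding is_Q_eigenvalue_iff[OF simple] by (rule exE)
  note eq = W[THEN conjunct2, rule_format]
  have mu: "\<mu> > 6" using n big by simp
  have cH: "real (card H) = real n - 2" using card_H card by simp
  have "H \<noteq> {}" using card_H card n by auto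
  let ?S = "\<Sum>j\<in>H. w j"
  have eu: "(real n - 1) * w u + w v + ?S = \<mu> * w u" and ev: "(real n - 1) * w v + w u + ?S = \<mu> * w v"
    using eq[OF uv(1)] eq[OF uv(2)] cH by (simp_all add: sum_nbrs_dom degree_dom algebra_simps)
  have "(\<mu> - real n + 2) * (w u - w v) = 0" using eu ev by (simp add: algebra_simps)
  then have wuv: "w v = w u" using big by simp
  have eH: "(\<mu> - 2 - real (card (h i))) * w i = 2 * w u + (\<Sum>j\<in>h i. w j)" if "i \<in> H" for i
  proof -
    have "i \<in> verts G" using that by (simp add: H_def)
    from eq[OF this] show ?thesis
      unfolding sum_nbrs_H[OF that] degree_H[OF that] wuv by (simp add: algebra_simps)
  qed
  have t: "w u \<noteq> 0"
  proof
    assume t0: "w u = 0"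
    have fin: "finite ((\<lambda>i. \<bar>w i\<bar>) ` H)" "(\<lambda>i. \<bar>w i\<bar>) ` H \<noteq> {}" using finite_H \<open>H \<noteq> {}\<close> by auto
    obtain i where i: "i \<in> H" "Max ((\<lambda>i. \<bar>w i\<bar>) ` H) = \<bar>w i\<bar>" using Max_in[OF fin] by auto
    have le: "\<bar>w j\<bar> \<le> \<bar>w i\<bar>" if "j \<in> H" for j
      using Max_ge[OF fin(1), of "\<bar>w j\<bar>"] that i(2) by simp
    have "(\<mu> - 2 - real (card (h i))) * \<bar>w i\<bar> = \<bar>(\<mu> - 2 - real (card (h i))) * w i\<bar>"
      using mu h2[OF i(1)] by (simp add: abs_mult)
    also have "\<dots> \<le> (\<Sum>j\<in>h i. \<bar>w j\<bar>)" unfolding eH[OF i(1)] t0 by simp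
    also have "\<dots> \<le> (\<Sum>j\<in>h i. \<bar>w i\<bar>)" using h_subset by (intro sum_mono le) auto
    finally have "(\<mu> - 2 - 2 * real (card (h i))) * \<bar>w i\<bar> \<le> 0" by (simp add: algebra_simps)
    moreover have "\<mu> - 2 - 2 * real (card (h i)) > 0" using mu h2[OF i(1)] by simp
    ultimately have "w i = 0" by (simp add: mult_le_0_iff)
    then have "\<forall>j\<in>H. w j = 0" using le by fastforce
    then show False using W t0 wuv by (auto simp: H_def)
  qed
  define y where "y i = w i / w u" for i
  have y: "(\<mu> - 2 - real (card (h i))) * y i = 2 + (\<Sum>j\<in>h i. y j)" if "i \<in> H" for i
    using eH[OF that] t unfolding y_def sum_divide_distrib[symmetric] by (simp add: field_simps)
  have fin: "finite (y ` H)" "y ` H \<noteq> {}" using finite_H \<open>H \<noteq> {}\<close> by auto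
  obtain i where i: "i \<in> H" "Min (y ` H) = y i" using Min_in[OF fin] by auto
  have le: "y i \<le> y j" if "j \<in> H" for j using Min_le[OF fin(1), of "y j"] that i(2) by simp
  have "(\<Sum>j\<in>h i. y i) \<le> (\<Sum>j\<in>h i. y j)" using h_subset by (intro sum_mono le) auto
  then have "(\<mu> - 2 - 2 * real (card (h i))) * y i \<ge> 2" using y[OF i(1)] by (simp add: algebra_simps)
  moreover have "\<mu> - 2 - 2 * real (card (h i)) > 0" using mu h2[OF i(1)] by simp
  ultimately have "y i > 0" by (smt (verit) mult_nonneg_nonpos)
  then have "\<And>j. j \<in> H \<Longrightarrow> y j > 0" using le by fastforce
  moreover have "(\<Sum>j\<in>H. y j) = \<mu> - real n"
    using eu t wuv unfolding y_def sum_divide_distrib[symmetric] by (simp add: field_simps)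
  ultimately show ?thesis using y that by blast
qed

text \<open>In the sum of the rows over \<open>H\<close> each \<open>y w\<close> appears on the
  right once per neighbour of \<open>w\<close>. Replacing the degree by 2 minus its deficit leaves
  only the total, known to be \<open>\<mu> - real n\<close>, and the deficit sum.\<close>

lemma deficit_identity:
  assumes card: "card (verts G) = n"
    and y: "\<And>w. w \<in> H \<Longrightarrow> (\<mu> - 2 - real (card (h w))) * y w = 2 + (\<Sum>j\<in>h w. y j)"
    and sum: "(\<Sum>w\<in>H. y w) = \<mu> - real n"
  shows "(\<mu> - 6) * (\<mu> - real n) + 2 * (\<Sum>w\<in>H. (2 - real (card (h w))) * y w) = 2 * (real n - 2)"
proof -
  have "(\<Sum>w\<in>H. (\<mu> - 2 - real (card (h w))) * y w) = (\<Sum>w\<in>H. 2 + (\<Sum>j\<in>h w. y j))"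
    using y by (intro sum.cong) auto
  also have "\<dots> = 2 * (real n - 2) + (\<Sum>j\<in>H. real (card (h j)) * y j)"
    using card_H card by (simp add: sum.distrib sum_sum_h)
  also have "(\<Sum>w\<in>H. (\<mu> - 2 - real (card (h w))) * y w)
      = (\<mu> - 2) * (\<Sum>w\<in>H. y w) - (\<Sum>w\<in>H. real (card (h w)) * y w)"
    by (simp add: left_diff_distrib sum_subtractf sum_distrib_left)
  moreover have "(\<Sum>w\<in>H. (2 - real (card (h w))) * y w)
      = 2 * (\<Sum>w\<in>H. y w) - (\<Sum>w\<in>H. real (card (h w)) * y w)"
    by (simp add: left_diff_distrib sum_subtractf sum_distrib_left)
  ultimately show ?thesis unfolding sum by (simp add: algebra_simps)
qed

text \<open>By \<open>long_cycle_K33_minor\<close> the two neighbours of a vertex in a 2-regular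
  closed part are adjacent, so this part is a union of triangles.\<close>

lemma two_regular_enumeration:
  assumes K: "\<not> has_minor G (complete_bipartite 3 3)"
    and T: "T \<subseteq> H" "\<And>t. t \<in> T \<Longrightarrow> h t \<subseteq> T" "\<And>t. t \<in> T \<Longrightarrow> card (h t) = 2"
  shows "\<exists>p g. bij_betw g T {..<3 * p :: nat} \<and>
    (\<forall>s\<in>T. \<forall>t\<in>T. s \<noteq> t \<longrightarrow> (t \<in> h s \<longleftrightarrow> g s div 3 = g t div 3))"
proof (rule disjoint_triangles_enumeration)
  show "finite T" using T(1) finite_H finite_subset by blast
  show "h t \<subseteq> T \<and> card (h t) = 2 \<and> t \<notin> h t" if "t \<in> T" for t using T that h_irrefl by blast
  show "t \<in> h s" if "s \<in> T" "t \<in> T" "s \<in> h t" for s t using h_sym that T(1) by blast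
  show "b \<in> h a" if t: "t \<in> T" "a \<in> h t" "b \<in> h t" "a \<noteq> b" for t a b
  proof (rule ccontr)
    assume "b \<notin> h a"
    then have "b \<notin> nbrs G a" using t by (simp add: h_def)
    moreover have "h t = {a, b}" using card_2_eq[OF T(3)[OF t(1)] t(2-4)] .
    ultimately have "has_minor G (complete_bipartite 3 3)"
      using T t(1,4) uv simple dom
      by (intro long_cycle_K33_minor[of u v G T t a b]) (auto simp: h_def H_def)
    with K show False by simp
  qed
qed

lemma three_dvd_two_regular:
  assumes "\<not> has_minor G (complete_bipartite 3 3)"
    and "T \<subseteq> H" "\<And>t. t \<in> T \<Longrightarrow> h t \<subseteq> T" "\<And>t. t \<in> T \<Longrightarrow> card (h t) = 2"
  shows "3 dvd card T"
  using two_regular_enumeration[OF assms] by (auto dest: bij_betw_same_card)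

text \<open>Only isolated vertices (\<open>Z\<close>) and path ends (\<open>L\<close>) of the rest
  contribute to \<open>W\<close>: each isolated vertex exactly 4/(\<mu> - 2), each path end at least
  2/(\<mu> - 4). Path ends come in even number; without them everything outside \<open>Z\<close> is
  triangles and |Z| is congruent to \<open>r\<close> modulo 3. The required bound is 0, 4/(\<mu> -
  2) or 4/(\<mu> - 4) for r = 0, 1, 2, which leaves few cases.\<close>

lemma deficit_bound:
  assumes K: "\<not> has_minor G (complete_bipartite 3 3)" and mu: "\<mu> > 6"
    and card: "card H = 3 * p + r" and r: "r < 3"
    and pos: "\<And>w. w \<in> H \<Longrightarrow> y w > 0"
    and y: "\<And>w. w \<in> H \<Longrightarrow> (\<mu> - 2 - real (card (h w))) * y w = 2 + (\<Sum>j\<in>h w. y j)"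
  defines "W \<equiv> (\<Sum>w\<in>H. (2 - real (card (h w))) * y w)"
  shows "2 * real r * (3 - real r) \<le> W * (\<mu> - 2 * real r)"
    and "W * (\<mu> - 2 * real r) = 2 * real r * (3 - real r) \<Longrightarrow>
      \<exists>X\<subseteq>H. card X = r \<and> (\<forall>a\<in>X. h a = X - {a}) \<and> (\<forall>a\<in>H - X. card (h a) = 2)"
proof -
  define Z where "Z = {w \<in> H. card (h w) = 0}"
  define L where "L = {w \<in> H. card (h w) = 1}"
  note h2 = card_h_le_2[OF K]
  have fin: "finite Z" "finite L" "Z \<subseteq> H" "L \<subseteq> H" "Z \<inter> L = {}" using finite_H by (auto simp: Z_def L_def)
  have rest: "card (h w) = 2" if "w \<in> H - (Z \<union> L)" for w
    using that h2[of w] by (auto simp: Z_def L_def)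
  have sumZL: "(\<Sum>w\<in>H. f w) = (\<Sum>w\<in>Z. f w) + (\<Sum>w\<in>L. f w) + (\<Sum>w\<in>H - (Z \<union> L). f w)"
    for f :: "'a \<Rightarrow> 'b::comm_monoid_add"
    using sum.subset_diff[of "Z \<union> L" H f] finite_H fin by (simp add: sum.union_disjoint add.commute)
  have yZ: "y w = 2 / (\<mu> - 2)" if "w \<in> Z" for w
    using y[of w] that finite_h[of w] mu by (auto simp: Z_def field_simps)
  have yL: "2 / (\<mu> - 4) \<le> y w \<and> (y w = 2 / (\<mu> - 4) \<longrightarrow> h w \<subseteq> L)" if w: "w \<in> L" for w
  proof -
    have wH: "w \<in> H" and "card (h w) = 1" using w by (auto simp: L_def)
    then obtain z where z: "h w = {z}" by (auto simp: card_1_singleton_iff)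
    then have zH: "z \<in> H" and wz: "w \<in> h z" using h_subset h_sym[OF wH] by blast+
    have ew: "(\<mu> - 3) * y w = 2 + y z" using y[OF wH] z by simp
    have "card (h z) \<noteq> 0" using wz finite_h[of z] by auto
    then consider "card (h z) = 1" | "card (h z) = 2" using h2[OF zH] by linarith
    then show ?thesis
    proof cases
      case 1
      then have zL: "z \<in> L" using zH by (simp add: L_def)
      have "h z = {w}" using 1 wz by (auto simp: card_1_singleton_iff)
      then have "(\<mu> - 3) * y z = 2 + y w" using y[OF zH] by simp
      then have "(\<mu> - 2) * (y w - y z) = 0" using ew by (simp add: algebra_simps)
      then have "y w = y z" using mu by simp
      then have "(\<mu> - 4) * y w = 2" using ew by (simp add: algebra_simps)
      then have "y w = 2 / (\<mu> - 4)" using mu by (simp add: field_simps)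
      then show ?thesis using z zL by simp
    next
      case 2
      \<comment> \<open>On a path with more than two vertices the positive entry at \<open>q\<close>
        pushes \<open>y w\<close> strictly above 2/(\<mu> - 4), the value on an isolated
        edge.\<close>
      then obtain q where q: "h z = {w, q}" "q \<noteq> w" by (rule card_2_other[OF _ wz])
      then have "y q > 0" using h_subset pos by blast
      moreover have "(\<mu> - 4) * y z = 2 + (y w + y q)" using y[OF zH] q 2 by simp
      ultimately have "(\<mu> - 4) * y z > 2 + y w" by simp
      then have "(\<mu> - 4) * ((\<mu> - 3) * y w - 2) > 2 + y w" using ew by simp
      then have *: "(\<mu> - 3) * ((\<mu> - 4) * y w) > 2 * (\<mu> - 3) + y w" by (simp add: algebra_simps)
      have "(\<mu> - 4) * y w > 2"
      proof (rule ccontr)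
        assume "\<not> ?thesis"
        then have "(\<mu> - 3) * ((\<mu> - 4) * y w) \<le> (\<mu> - 3) * 2" using mu by (intro mult_left_mono) auto
        then show False using * pos[OF wH] by simp
      qed
      then have "y w > 2 / (\<mu> - 4)" using mu by (simp add: field_simps)
      then show ?thesis by simp
    qed
  qed
  define \<zeta> where "\<zeta> = real (card Z) * (4 / (\<mu> - 2))"
  have W: "W = \<zeta> + (\<Sum>w\<in>L. y w)"
  proof -
    have "(\<Sum>w\<in>Z. (2 - real (card (h w))) * y w) = (\<Sum>w\<in>Z. 4 / (\<mu> - 2))"
      using yZ by (intro sum.cong) (auto simp: Z_def)
    moreover have "(\<Sum>w\<in>L. (2 - real (card (h w))) * y w) = (\<Sum>w\<in>L. y w)"
      by (intro sum.cong) (auto simp: L_def)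
    moreover have "(\<Sum>w\<in>H - (Z \<union> L). (2 - real (card (h w))) * y w) = 0"
      using rest by (intro sum.neutral) auto
    ultimately show ?thesis unfolding W_def sumZL \<zeta>_def by simp
  qed
  have WL: "real (card L) * (2 / (\<mu> - 4)) \<le> (\<Sum>w\<in>L. y w)"
    using sum_mono[of L "\<lambda>_. 2 / (\<mu> - 4)" y] yL by simp
  have evenL: "even (card L)"
  proof -
    have "(\<Sum>w\<in>H. card (h w)) = card L + 2 * card (H - (Z \<union> L))"
    proof -
      have "(\<Sum>w\<in>Z. card (h w)) = 0" by (simp add: Z_def)
      moreover have "(\<Sum>w\<in>L. card (h w)) = card L" by (simp add: L_def)
      moreover have "(\<Sum>w\<in>H - (Z \<union> L). card (h w)) = 2 * card (H - (Z \<union> L))" using rest by simp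
      ultimately show ?thesis unfolding sumZL by simp
    qed
    then show ?thesis using even_sum_card_h by simp
  qed
  have noL: "r = card Z mod 3" if "L = {}"
  proof -
    have cl: "h t \<subseteq> H - Z" if t: "t \<in> H - Z" for t
    proof
      fix x assume x: "x \<in> h t"
      then have "x \<in> H" "t \<in> h x" using h_subset h_sym t by blast+
      then have "card (h x) \<noteq> 0" using finite_h[of x] by auto
      then show "x \<in> H - Z" using \<open>x \<in> H\<close> by (simp add: Z_def)
    qed
    have "card (h t) = 2" if "t \<in> H - Z" for t using rest that \<open>L = {}\<close> by simp
    with cl have "3 dvd card (H - Z)" by (intro three_dvd_two_regular[OF K]) auto
    moreover have "card (H - Z) = 3 * p + r - card Z" "card Z \<le> 3 * p + r"
      using fin card card_Diff_subset[of Z H] card_mono[OF finite_H fin(3)] by auto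
    ultimately show ?thesis using r by presburger
  qed
  \<comment> \<open>The last inequality is equivalent to \<open>\<mu>\<close> > 6; for r = 2 it
    makes two isolated vertices worse than one isolated edge.\<close>
  have fracs: "2 / (\<mu> - 4) > 0" "4 / (\<mu> - 2) > 0" "4 / (\<mu> - 4) > 4 / (\<mu> - 2)" "8 / (\<mu> - 2) > 4 / (\<mu> - 4)"
    using mu by (simp_all add: field_simps)
  have L2: "card L \<ge> 2" if "L \<noteq> {}"
  proof -
    have "card L \<noteq> 0" using that fin by simp
    then show ?thesis using evenL by presburger
  qed
  have Lpos: "0 \<le> (\<Sum>w\<in>L. y w)" using WL fracs(1) by (smt (verit) mult_nonneg_nonneg of_nat_0_le_iff)
  have WLle: "4 / (\<mu> - 4) \<le> (\<Sum>w\<in>L. y w)" if "L \<noteq> {}"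
  proof -
    have "2 * (2 / (\<mu> - 4)) \<le> real (card L) * (2 / (\<mu> - 4))"
      using L2[OF that] fracs by (intro mult_right_mono) auto
    then show ?thesis using WL by simp
  qed
  have Z0: "0 \<le> \<zeta>" unfolding \<zeta>_def using fracs(2) by (intro mult_nonneg_nonneg) auto
  have Z1: "4 / (\<mu> - 2) \<le> \<zeta>" if "card Z \<ge> 1"
    using mult_right_mono[of 1 "real (card Z)" "4 / (\<mu> - 2)"] that fracs(2) by (simp add: \<zeta>_def)
  have Z2: "8 / (\<mu> - 2) \<le> \<zeta>" if "card Z \<ge> 2"
    using mult_right_mono[of 2 "real (card Z)" "4 / (\<mu> - 2)"] that fracs(2) by (simp add: \<zeta>_def)
  text \<open>The minimal deficit, attained by a clique on \<open>r\<close> vertices and triangles.\<close>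
  define D where "D = 2 * real r * (3 - real r) / (\<mu> - 2 * real r)"
  have den: "\<mu> - 2 * real r > 0" using mu r by simp
  have iff: "2 * real r * (3 - real r) \<le> W * (\<mu> - 2 * real r) \<longleftrightarrow> D \<le> W"
    "W * (\<mu> - 2 * real r) = 2 * real r * (3 - real r) \<longleftrightarrow> W = D"
    unfolding D_def using den by (auto simp: field_simps)
  have key: "D \<le> W \<and> (W = D \<longrightarrow> (\<exists>X\<subseteq>H. card X = r \<and> (\<forall>a\<in>X. h a = X - {a}) \<and> (\<forall>a\<in>H - X. card (h a) = 2)))"
  proof -
    consider "r = 0" | "r = 1" | "r = 2" using r by linarith
    then show ?thesis
    proof cases
      case 1
      then have D: "D = 0" by (simp add: D_def)
      have "\<exists>X\<subseteq>H. card X = r \<and> (\<forall>a\<in>X. h a = X - {a}) \<and> (\<forall>a\<in>H - X. card (h a) = 2)" if "W = D"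
      proof -
        have "L = {}"
        proof (rule ccontr)
          assume "L \<noteq> {}"
          from WLle[OF this] show False using W Z0 fracs that D by linarith
        qed
        moreover have "card Z = 0"
        proof (rule ccontr)
          assume "card Z \<noteq> 0"
          then show False using W Z1 Lpos fracs that D by linarith
        qed
        ultimately have "\<forall>a\<in>H - {}. card (h a) = 2" using rest fin by simp
        then show ?thesis using 1 by (intro exI[of _ "{}"]) simp
      qed
      moreover have "D \<le> W" using W Z0 Lpos D by linarith
      ultimately show ?thesis by blast
    next
      case 2
      then have D: "D = 4 / (\<mu> - 2)" by (simp add: D_def)
      show ?thesis
      proof (cases "L = {}")
        case False
        from WLle[OF this] have "W > D" using W Z0 fracs D by linarith
        then show ?thesis by simp
      next
        case True
        then have Z: "card Z \<ge> 1" using noL 2 by (cases "card Z") auto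
        have WeqZ: "W = \<zeta>" using W True by simp
        have "\<exists>X\<subseteq>H. card X = r \<and> (\<forall>a\<in>X. h a = X - {a}) \<and> (\<forall>a\<in>H - X. card (h a) = 2)" if "W = D"
        proof -
          have "real (card Z) * (4 / (\<mu> - 2)) = 1 * (4 / (\<mu> - 2))" using that D WeqZ by (simp add: \<zeta>_def)
          then have "card Z = 1" using fracs(2) by (simp only: mult_cancel_right) auto
          then obtain x where x: "Z = {x}" by (auto simp: card_1_singleton_iff)
          then have "x \<in> Z" by simp
          then have "h x = {}" using finite_h[of x] by (simp add: Z_def)
          then show ?thesis using x fin(3) rest True 2 by (intro exI[of _ Z]) simp
        qed
        moreover have "D \<le> W" using Z1[OF Z] D WeqZ by linarith
        ultimately show ?thesis by blast
      qed
    next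
      case 3
      then have D: "D = 4 / (\<mu> - 4)" by (simp add: D_def)
      show ?thesis
      proof (cases "L = {}")
        case True
        then have "card Z \<ge> 2" using noL 3 by (cases "card Z < 2") (auto simp: less_2_cases_iff)
        from Z2[OF this] have "W > D" using W Lpos fracs D by linarith
        then show ?thesis by simp
      next
        case False
        have "\<exists>X\<subseteq>H. card X = r \<and> (\<forall>a\<in>X. h a = X - {a}) \<and> (\<forall>a\<in>H - X. card (h a) = 2)" if WD: "W = D"
        proof -
          have "card Z = 0"
          proof (rule ccontr)
            assume "card Z \<noteq> 0"
            then show False using W Z1 WLle[OF False] fracs WD D by linarith
          qed
          then have Z: "Z = {}" using fin by simp
          then have sL: "(\<Sum>w\<in>L. y w) = 4 / (\<mu> - 4)" using W WD D by (simp add: \<zeta>_def)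
          have "real (card L) * (2 / (\<mu> - 4)) \<le> 2 * (2 / (\<mu> - 4))" using WL sL by simp
          then have "card L \<le> 2" using fracs(1) by (simp only: mult_le_cancel_right) auto
          then have cL: "card L = 2" using L2[OF False] by simp
          \<comment> \<open>A vanishing sum of nonnegative excesses: both path ends attain the
            minimum of \<open>yL\<close>, so they are adjacent to each other.\<close>
          have "(\<Sum>w\<in>L. y w - 2 / (\<mu> - 4)) = 0" using sL cL by (simp add: sum_subtractf)
          then have "\<forall>w\<in>L. y w - 2 / (\<mu> - 4) = 0"
            using sum_nonneg_eq_0_iff[OF fin(2), of "\<lambda>w. y w - 2 / (\<mu> - 4)"] yL by simp
          then have hL: "h w \<subseteq> L" if "w \<in> L" for w using yL[OF that] that by simp
          have "h w = L - {w}" if w: "w \<in> L" for w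
          proof (rule card_subset_eq)
            show "h w \<subseteq> L - {w}" using hL[OF w] h_irrefl by blast
            show "card (h w) = card (L - {w})" using cL w fin by (simp add: L_def)
          qed (use fin in simp)
          then show ?thesis using cL 3 fin rest Z by (intro exI[of _ L]) simp
        qed
        moreover have "D \<le> W" using W Z0 WLle[OF False] D by linarith
        ultimately show ?thesis by blast
      qed
    qed
  qed
  from key show "2 * real r * (3 - real r) \<le> W * (\<mu> - 2 * real r)" by (simp only: iff)
  from key show "W * (\<mu> - 2 * real r) = 2 * real r * (3 - real r) \<Longrightarrow>
      \<exists>X\<subseteq>H. card X = r \<and> (\<forall>a\<in>X. h a = X - {a}) \<and> (\<forall>a\<in>H - X. card (h a) = 2)" by (simp only: iff)
qed

end

section \<open>The extremal graph\<close>

lemma verts_F33: "verts (F33 n) = {..<n}"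
  by (simp add: F33_def)

lemma edges_F33: "{i, j} \<in> edges (F33 n) \<longleftrightarrow>
    i < n \<and> j < n \<and> i \<noteq> j \<and> (i < 2 \<or> j < 2 \<or> (i - 2) div 3 = (j - 2) div 3)"
  by (auto simp: F33_def doubleton_eq_iff)

lemma simple_F33: "simple_graph (F33 n)"
  by (rule simple_graphI) (auto simp: F33_def)

lemma dominating_pair_F33: "n \<ge> 2 \<Longrightarrow> dominating_pair (F33 n) 0 (Suc 0)"
  using no_loop[OF simple_F33[of n]]
  by unfold_locales (auto simp: simple_F33 verts_F33 nbrs_iff edges_F33)

context dominating_pair
begin

text \<open>The triangles outside \<open>X\<close> fill the first \<open>p\<close> blocks of three
  and the clique \<open>X\<close> takes the incomplete last block. Adding 2 makes room for
  \<open>u\<close> and \<open>v\<close> as 0 and 1.\<close>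

lemma graph_iso_F33:
  assumes K: "\<not> has_minor G (complete_bipartite 3 3)"
    and card: "card (verts G) = n" "n - 2 = 3 * p + r" and r: "r < 3"
    and X: "X \<subseteq> H" "card X = r" "\<And>a. a \<in> X \<Longrightarrow> h a = X - {a}" "\<And>a. a \<in> H - X \<Longrightarrow> card (h a) = 2"
  shows "graph_iso G (F33 n)"
proof -
  have n: "n = 3 * p + r + 2" and cH: "card H = 3 * p + r" using card card_H by auto
  have finX: "finite X" using X(1) finite_H finite_subset by blast
  have out: "x \<notin> h t" if "x \<in> X" "t \<in> H - X" for x t
  proof
    assume "x \<in> h t"
    then have "t \<in> h x" using h_sym that X(1) by blast
    then show False using X(3) that by auto
  qed
  then have cl: "h t \<subseteq> H - X" if "t \<in> H - X" for t using that h_subset[of t] by blast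
  have "\<exists>p g. bij_betw g (H - X) {..<3 * p :: nat} \<and>
      (\<forall>s\<in>H - X. \<forall>t\<in>H - X. s \<noteq> t \<longrightarrow> (t \<in> h s \<longleftrightarrow> g s div 3 = g t div 3))"
    by (rule two_regular_enumeration[OF K Diff_subset]) (use cl X(4) in blast)+
  then obtain p' g where g': "bij_betw g (H - X) {..<3 * p' :: nat}"
    and gh: "\<forall>s\<in>H - X. \<forall>t\<in>H - X. s \<noteq> t \<longrightarrow> (t \<in> h s \<longleftrightarrow> g s div 3 = g t div 3)"
    by (elim exE conjE)
  have "card (H - X) = 3 * p" using card_Diff_subset[OF finX X(1)] X(2) cH by simp
  then have "p' = p" using bij_betw_same_card[OF g'] by simp
  then have g: "bij_betw g (H - X) {..<3 * p}" using g' by simp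
  obtain e where e: "bij_betw e X {3 * p..<3 * p + r}"
    using finite_same_card_bij[OF finX, of "{3 * p..<3 * p + r}"] X(2) by auto
  define k where "k x = (if x \<in> X then e x else g x)" for x
  have kX: "bij_betw k X {3 * p..<3 * p + r}"
    using e by (subst bij_betw_cong[of X k e]) (simp_all add: k_def)
  have kT: "bij_betw k (H - X) {..<3 * p}"
    using g by (subst bij_betw_cong[of "H - X" k g]) (simp_all add: k_def)
  have dX: "k x div 3 = p" if "x \<in> X" for x
  proof -
    have "k x \<in> {3 * p..<3 * p + r}" using bij_betwE[OF kX] that by blast
    then show ?thesis using r by auto
  qed
  have dT: "k x div 3 < p" if "x \<in> H - X" for x
  proof -
    have "k x < 3 * p" using bij_betwE[OF kT] that by blast
    then show ?thesis by (simp add: div_less_iff_less_mult)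
  qed
  have kh: "t \<in> h s \<longleftrightarrow> k s div 3 = k t div 3" if st: "s \<in> H" "t \<in> H" "s \<noteq> t" for s t
  proof -
    consider "s \<in> X" "t \<in> X" | "s \<in> X" "t \<in> H - X" | "s \<in> H - X" "t \<in> X" | "s \<in> H - X" "t \<in> H - X"
      using st by blast
    then show ?thesis
    proof cases
      case 1
      then show ?thesis using X(3) dX st(3) by auto
    next
      case 2
      then have "t \<notin> h s" using X(3) by auto
      then show ?thesis using dX[OF 2(1)] dT[OF 2(2)] by simp
    next
      case 3
      then show ?thesis using out dX[OF 3(2)] dT[OF 3(1)] by auto
    next
      case 4
      then show ?thesis using gh st(3) by (simp add: k_def)
    qed
  qed
  have kH: "bij_betw k H {..<3 * p + r}"
  proof -
    have "bij_betw k ((H - X) \<union> X) ({..<3 * p} \<union> {3 * p..<3 * p + r})"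
      by (rule bij_betw_combine[OF kT kX]) auto
    moreover have "(H - X) \<union> X = H" "{..<3 * p} \<union> {3 * p..<3 * p + r} = {..<3 * p + r}"
      using X(1) by auto
    ultimately show ?thesis by simp
  qed
  define f where "f x = (if x = u then 0 else if x = v then 1 else k x + 2)" for x
  have fH: "f x = k x + 2" if "x \<in> H" for x using that by (auto simp: f_def H_def)
  have fuv: "f u = 0" "f v = 1" using uv by (auto simp: f_def)
  have f: "bij_betw f (verts G) {..<n}"
  proof -
    have "bij_betw f ({u, v} \<union> H) ({0, 1} \<union> {2..<n})"
    proof (rule bij_betw_combine)
      show "bij_betw f {u, v} {0, 1}" using uv(3) fuv by (auto simp: bij_betw_def inj_on_def)
      have "bij_betw (\<lambda>i. i + 2) {..<3 * p + r} {2..<n}"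
        by (rule bij_betw_byWitness[where f' = "\<lambda>i. i - 2"]) (auto simp: n)
      from bij_betw_trans[OF kH this] show "bij_betw f H {2..<n}"
        by (subst bij_betw_cong[of H f "(\<lambda>i. i + 2) \<circ> k"]) (simp_all add: fH)
    qed auto
    moreover have "{u, v} \<union> H = verts G" using uv by (auto simp: H_def)
    moreover have "{0, 1} \<union> {2..<n} = {..<n}" using n by auto
    ultimately show ?thesis by simp
  qed
  have fn: "f a < n" if "a \<in> verts G" for a using bij_betwE[OF f] that by auto
  have fne: "f a \<noteq> f b" if "a \<in> verts G" "b \<in> verts G" "a \<noteq> b" for a b
    using f that by (auto simp: bij_betw_def inj_on_eq_iff)
  have "{a, b} \<in> edges G \<longleftrightarrow> {f a, f b} \<in> edges (F33 n)" if ab: "a \<in> verts G" "b \<in> verts G" for a b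
  proof (cases "a = b")
    case True
    then show ?thesis using no_loop[OF simple] no_loop[OF simple_F33] by simp
  next
    case False
    note F = edges_F33[of "f a" "f b" n] fn[OF ab(1)] fn[OF ab(2)] fne[OF ab False]
    have N: "{a, b} \<in> edges G \<longleftrightarrow> b \<in> nbrs G a" using ab by (simp add: nbrs_iff)
    consider "a = u \<or> a = v" | "b = u \<or> b = v" | "a \<in> H" "b \<in> H" using ab by (auto simp: H_def)
    then show ?thesis
    proof cases
      case 1
      then have "b \<in> nbrs G a" using dom ab False by auto
      moreover have "f a < 2" using 1 fuv by auto
      ultimately show ?thesis using N F by simp
    next
      case 2
      then have "a \<in> nbrs G b" using dom ab False by auto
      then have "b \<in> nbrs G a" using nbrs_sym[OF simple] by blast
      moreover have "f b < 2" using 2 fuv by auto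
      ultimately show ?thesis using N F by simp
    next
      case 3
      have "b \<in> nbrs G a \<longleftrightarrow> b \<in> h a" using 3 by (simp add: h_def H_def)
      then show ?thesis using N F kh[OF 3 False] fH[OF 3(1)] fH[OF 3(2)] by simp
    qed
  qed
  then show ?thesis unfolding graph_iso_def verts_F33 using f by blast
qed

end

section \<open>The cubic and its largest root\<close>

definition F33_poly :: "nat \<Rightarrow> nat \<Rightarrow> real \<Rightarrow> real" where
  "F33_poly n r x = x^3 - (real n + 2 * real r + 6) * x^2
     + (12 * real r + 4 * real n + 2 * real r * real n + 4) * x
     + 4 * real r - 8 * real r * real n - 4 * (real r)^2"

text \<open>This is the characteristic polynomial of the quotient matrix for the classes K_2,
  triangles and K_r, with diagonal entries n, 6 and 2r. For r = 0 the last class is empty and only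
  adds the factor x.\<close>

lemma F33_poly_eq:
  "F33_poly n r x = (x - real n) * (x - 6) * (x - 2 * real r)
     - 2 * (real n - 2 - real r) * (x - 2 * real r) - 2 * real r * (x - 6)"
  by (simp add: F33_poly_def algebra_simps power2_eq_square power3_eq_cube)

text \<open>The shape that meets \<open>deficit_identity\<close>: at an eigenvalue the difference in
  the outer bracket is -2W.\<close>

lemma F33_poly_eq':
  "F33_poly n r x = ((x - 6) * (x - real n) - 2 * (real n - 2)) * (x - 2 * real r) + 4 * real r * (3 - real r)"
  by (simp add: F33_poly_def algebra_simps power2_eq_square power3_eq_cube)

text \<open>The last factor vanishes exactly when the row of a dominating vertex holds with entries
  2/(t - 6) on triangles and 2/(t - 2r) on the small clique.\<close>

lemma F33_poly_factor:
  assumes "t \<noteq> 6" "t \<noteq> 2 * real r"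
  shows "F33_poly n r t = (t - 6) * (t - 2 * real r) *
    (t - real n - 2 * (real n - 2 - real r) / (t - 6) - 2 * real r / (t - 2 * real r))"
proof -
  define a where "a = 2 * (real n - 2 - real r) / (t - 6)"
  define b where "b = 2 * real r / (t - 2 * real r)"
  have e: "2 * (real n - 2 - real r) * (t - 2 * real r) = (t - 6) * (t - 2 * real r) * a"
    "2 * real r * (t - 6) = (t - 6) * (t - 2 * real r) * b"
    using assms by (simp_all add: a_def b_def)
  have "F33_poly n r t = (t - 6) * (t - 2 * real r) * (t - real n - a - b)"
    unfolding F33_poly_eq e by (simp add: algebra_simps)
  then show ?thesis by (simp add: a_def b_def)
qed

text \<open>Beyond n + 2 the last factor in \<open>F33_poly_factor\<close> is strictly increasing
  and the other two are positive, so the cubic is positive beyond \<open>\<rho>\<close>. The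
  hypothesis is an inequality in order to cover both the other roots and the index of a competing
  graph.\<close>

lemma F33_poly_root_max:
  assumes n: "n \<ge> 10" "r < 3" and \<rho>: "\<rho> > real n + 2" "F33_poly n r \<rho> = 0"
    and x: "F33_poly n r x \<le> 0"
  shows "x \<le> \<rho>"
proof (rule ccontr)
  assume "\<not> ?thesis"
  then have lt: "\<rho> < x" by simp
  define g where "g t = t - real n - 2 * (real n - 2 - real r) / (t - 6) - 2 * real r / (t - 2 * real r)" for t
  have gp: "F33_poly n r t = (t - 6) * (t - 2 * real r) * g t" if "t > real n + 2" for t
    unfolding g_def by (rule F33_poly_factor) (use that n in auto)
  have pos: "\<rho> - 6 > 0" "\<rho> - 2 * real r > 0" "x - 6 > 0" "x - 2 * real r > 0" using \<rho> lt n by auto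
  then have "g \<rho> = 0" using gp[OF \<rho>(1)] \<rho>(2) by simp
  have "2 * (real n - 2 - real r) / (x - 6) \<le> 2 * (real n - 2 - real r) / (\<rho> - 6)"
    using pos lt n by (intro divide_left_mono) auto
  moreover have "2 * real r / (x - 2 * real r) \<le> 2 * real r / (\<rho> - 2 * real r)"
    using pos lt by (intro divide_left_mono) auto
  ultimately have "g x > 0" using \<open>g \<rho> = 0\<close> lt unfolding g_def by linarith
  then have "(x - 6) * (x - 2 * real r) * g x > 0" using pos by simp
  then show False using x gp[of x] \<rho>(1) lt by simp
qed

lemma F33_poly_root_exists:
  assumes n: "n \<ge> 10" "r < 3"
  obtains \<rho> where "\<rho> > real n + 2" "F33_poly n r \<rho> = 0"
proof -
  have n': "real n \<ge> 10" using n by simp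
  have r: "r = 0 \<or> r = 1 \<or> r = 2" using n by auto
  \<comment> \<open>The value is -4(n + 2 - 2r) + 4r(3 - r). At n + 10 the outer bracket of
    \<open>F33_poly_eq'\<close> is 8n + 44, so the sign has changed.\<close>
  have neg: "F33_poly n r (real n + 2) < 0"
    using r n' unfolding F33_poly_eq by (auto simp: algebra_simps)
  have "F33_poly n r (real n + 10) \<ge> 0"
    using r n' mult_nonneg_nonneg[of "real n" "real n"] unfolding F33_poly_eq by (auto simp: algebra_simps)
  moreover have "continuous_on {real n + 2..real n + 10} (F33_poly n r)"
    unfolding F33_poly_def by (intro continuous_intros)
  ultimately obtain x where "real n + 2 \<le> x" "F33_poly n r x = 0"
    using IVT'[of "F33_poly n r" "real n + 2" 0 "real n + 10"] neg by auto
  then show ?thesis using neg that[of x] by (cases "x = real n + 2") auto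
qed

lemma q_index_F33:
  assumes n: "n \<ge> 10" "n - 2 = 3 * p + r" and r: "r < 3"
    and \<rho>: "\<rho> > real n + 2" "F33_poly n r \<rho> = 0"
  shows "q_index (F33 n) = \<rho>"
proof -
  interpret F: dominating_pair "F33 n" 0 "Suc 0" by (rule dominating_pair_F33) (use n in simp)
  have nn: "n = 3 * p + r + 2" using n by simp
  have H: "F.H = {2..<n}" by (auto simp: F.H_def verts_F33)
  have h: "F.h i = {j \<in> {2..<n}. (j - 2) div 3 = (i - 2) div 3} - {i}" if "i \<in> F.H" for i
    using that no_loop[OF simple_F33[of n]] by (auto simp: F.h_def H nbrs_iff verts_F33 edges_F33)
  have block: "{j \<in> {2..<n}. (j - 2) div 3 = q} = {3 * q + 2, 3 * q + 3, 3 * q + 4}" if "q < p" for q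
  proof (intro equalityI subsetI)
    fix j assume "j \<in> {j \<in> {2..<n}. (j - 2) div 3 = q}"
    then have "j \<ge> 2" "(j - 2) div 3 = q" by auto
    then have "j = 3 * q + 2 \<or> j = 3 * q + 3 \<or> j = 3 * q + 4" by presburger
    then show "j \<in> {3 * q + 2, 3 * q + 3, 3 * q + 4}" by simp
  next
    fix j assume "j \<in> {3 * q + 2, 3 * q + 3, 3 * q + 4}"
    then have "j = 3 * q + 2 \<or> j = 3 * q + 3 \<or> j = 3 * q + 4" by simp
    moreover from this have "(j - 2) div 3 = q" by (intro div_nat_eqI) auto
    ultimately have "j \<ge> 2" "j < n" "(j - 2) div 3 = q" using that nn by auto
    then show "j \<in> {j \<in> {2..<n}. (j - 2) div 3 = q}" by simp
  qed
  have last: "{j \<in> {2..<n}. (j - 2) div 3 = p} = {3 * p + 2..<n}"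
  proof (intro equalityI subsetI)
    fix j assume "j \<in> {j \<in> {2..<n}. (j - 2) div 3 = p}"
    then have "j < n" "j \<ge> 2" "(j - 2) div 3 = p" by auto
    then show "j \<in> {3 * p + 2..<n}" by auto
  next
    fix j assume "j \<in> {3 * p + 2..<n}"
    then have "j \<ge> 3 * p + 2" "j < n" by auto
    then have "(j - 2) div 3 = p" using nn r by (intro div_nat_eqI) auto
    then show "j \<in> {j \<in> {2..<n}. (j - 2) div 3 = p}" using \<open>j \<ge> 3 * p + 2\<close> \<open>j < n\<close> by simp
  qed
  \<comment> \<open>The truncated \<open>r - 1\<close> is harmless: an index in the last block
    exists only if r \<ge> 1.\<close>
  have card_h: "card (F.h i) = (if (i - 2) div 3 < p then 2 else r - 1)" if i: "i \<in> F.H" for i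
  proof -
    let ?B = "{j \<in> {2..<n}. (j - 2) div 3 = (i - 2) div 3}"
    have "i \<in> ?B" using i by (simp add: H)
    then have c: "card (F.h i) = card ?B - 1" unfolding h[OF i] by simp
    have "2 \<le> i" "i < n" using i by (simp_all add: H)
    then have "(i - 2) div 3 < Suc p" using nn r by (intro less_mult_imp_div_less) simp
    then have "(i - 2) div 3 < p \<or> (i - 2) div 3 = p" by auto
    then show ?thesis
    proof
      assume q: "(i - 2) div 3 < p"
      have "card ?B = 3" unfolding block[OF q] by simp
      then show ?thesis using c q by simp
    next
      assume q: "(i - 2) div 3 = p"
      have "card ?B = r" unfolding q last using nn by simp
      then show ?thesis using c q by simp
    qed
  qed
  have pos: "\<rho> > 6" "\<rho> > 2 * real r" using \<rho> n r by auto
  \<comment> \<open>The candidate eigenvector, constant on the three classes: the rows on triangles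
    and on the last clique dictate its values, and the cubic takes care of the rows of 0 and 1.
    Positivity then identifies \<open>\<rho>\<close> as the index.\<close>
  define y :: "nat \<Rightarrow> real" where
    "y i = (if i < 2 then 1 else if (i - 2) div 3 < p then 2 / (\<rho> - 6) else 2 / (\<rho> - 2 * real r))" for i
  have sumy: "(\<Sum>i\<in>F.H. y i) = \<rho> - real n"
  proof -
    have split: "F.H = {2..<3 * p + 2} \<union> {3 * p + 2..<n}" unfolding H using nn by auto
    have "(\<Sum>i\<in>F.H. y i) = (\<Sum>i\<in>{2..<3 * p + 2}. y i) + (\<Sum>i\<in>{3 * p + 2..<n}. y i)"
      unfolding split by (rule sum.union_disjoint) auto
    also have "(\<Sum>i\<in>{2..<3 * p + 2}. y i) = (\<Sum>i\<in>{2..<3 * p + 2}. 2 / (\<rho> - 6))"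
      by (intro sum.cong) (auto simp: y_def)
    also have "(\<Sum>i\<in>{3 * p + 2..<n}. y i) = (\<Sum>i\<in>{3 * p + 2..<n}. 2 / (\<rho> - 2 * real r))"
      by (intro sum.cong) (auto simp: y_def)
    finally have s: "(\<Sum>i\<in>F.H. y i) = 3 * real p * (2 / (\<rho> - 6)) + real r * (2 / (\<rho> - 2 * real r))"
      using nn by simp
    have p: "3 * real p = real n - 2 - real r" using nn by simp
    have "(\<Sum>i\<in>F.H. y i) = 2 * (real n - 2 - real r) / (\<rho> - 6) + 2 * real r / (\<rho> - 2 * real r)"
      unfolding s p by (simp add: algebra_simps)
    moreover have "\<rho> - real n - 2 * (real n - 2 - real r) / (\<rho> - 6) - 2 * real r / (\<rho> - 2 * real r) = 0"
      using F33_poly_factor[of \<rho> r n] \<rho>(2) pos by simp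
    ultimately show ?thesis by linarith
  qed
  have yh: "(\<Sum>j\<in>F.h i. y j) = real (card (F.h i)) * y i" if i: "i \<in> F.H" for i
  proof -
    have "(\<Sum>j\<in>F.h i. y j) = (\<Sum>j\<in>F.h i. y i)"
      using i by (intro sum.cong) (auto simp: h y_def H)
    then show ?thesis by simp
  qed
  have cH: "real (card F.H) = real n - 2" using F.card_H n by (simp add: verts_F33)
  have y0: "y 0 = 1" "y (Suc 0) = 1" by (simp_all add: y_def)
  have row: "real (degree (F33 n) i) * y i + (\<Sum>j\<in>nbrs (F33 n) i. y j) = \<rho> * y i"
    if i: "i \<in> verts (F33 n)" for i
  proof -
    have "i = 0 \<or> i = Suc 0 \<or> i \<in> F.H" using i unfolding H verts_F33 by (auto simp: not_less)
    then consider "i = 0" | "i = Suc 0" | "i \<in> F.H" by blast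
    then show ?thesis
    proof cases
      case 1
      show ?thesis unfolding 1 F.degree_dom F.sum_nbrs_dom sumy y0 using cH by simp
    next
      case 2
      show ?thesis unfolding 2 F.degree_dom F.sum_nbrs_dom sumy y0 using cH by simp
    next
      case 3
      have "(\<rho> - 2 - 2 * real (card (F.h i))) * y i = 2"
      proof (cases "(i - 2) div 3 < p")
        case True
        then have e: "\<rho> - 2 - 2 * real (card (F.h i)) = \<rho> - 6" "y i = 2 / (\<rho> - 6)"
          using 3 by (simp_all add: card_h[OF 3] y_def H)
        show ?thesis unfolding e using pos by (simp add: field_simps)
      next
        case False
        have "r \<ge> 1"
        proof (rule ccontr)
          assume "\<not> r \<ge> 1"
          moreover have "2 \<le> i" "i < n" using 3 by (simp_all add: H)
          ultimately have "(i - 2) div 3 < p" using nn by (intro less_mult_imp_div_less) simp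
          then show False using False by simp
        qed
        then have e: "\<rho> - 2 - 2 * real (card (F.h i)) = \<rho> - 2 * real r" "y i = 2 / (\<rho> - 2 * real r)"
          using False 3 by (simp_all add: card_h[OF 3] y_def H of_nat_diff)
        show ?thesis unfolding e using pos by (simp add: field_simps)
      qed
      then show ?thesis unfolding F.degree_H[OF 3] F.sum_nbrs_H[OF 3] y0 yh[OF 3]
        by (simp add: algebra_simps)
    qed
  qed
  show ?thesis
  proof (rule q_index_positive_eigenvector[OF simple_F33 _ _ row])
    show "verts (F33 n) \<noteq> {}" using n by (simp add: verts_F33 lessThan_empty_iff)
    show "y i > 0" for i using pos by (simp add: y_def)
  qed
qed

lemma K33_minor_free_q_index:
  fixes G :: "'a graph"
  assumes G: "simple_graph G" and n: "card (verts G) = n" "n \<ge> 1186"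
    and K: "\<not> has_minor G (complete_bipartite 3 3)"
    and pr: "n - 2 = 3 * p + r" "r < 3"
    and \<rho>: "\<rho> > real n + 2" "F33_poly n r \<rho> = 0"
  shows "q_index G \<le> \<rho>" "q_index G = \<rho> \<Longrightarrow> graph_iso G (F33 n)"
proof -
  define \<mu> where "\<mu> = q_index G"
  have ne: "verts G \<noteq> {}" using n by auto
  have ev: "is_Q_eigenvalue G \<mu>" unfolding \<mu>_def by (rule is_Q_eigenvalue_q_index[OF G ne])
  have "\<mu> \<le> \<rho> \<and> (\<mu> = \<rho> \<longrightarrow> graph_iso G (F33 n))"
  proof (cases "\<mu> > real n + 2")
    case False
    then show ?thesis using \<rho>(1) by auto
  next
    case True
    obtain u v where uv: "u \<in> verts G" "v \<in> verts G" "u \<noteq> v"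
      "nbrs G u = verts G - {u}" "nbrs G v = verts G - {v}"
      by (rule large_Q_eigenvalue_dominating_pair[OF G n K ev True])
    interpret dominating_pair G u v by unfold_locales (use G uv in auto)
    obtain y where y: "\<And>w. w \<in> H \<Longrightarrow> y w > 0"
      "\<And>w. w \<in> H \<Longrightarrow> (\<mu> - 2 - real (card (h w))) * y w = 2 + (\<Sum>j\<in>h w. y j)"
      "(\<Sum>w\<in>H. y w) = \<mu> - real n"
      using Q_eigenvector_H[OF n(1) _ card_h_le_2[OF K] ev True] n(2) by auto
    define W where "W = (\<Sum>w\<in>H. (2 - real (card (h w))) * y w)"
    have id: "(\<mu> - 6) * (\<mu> - real n) + 2 * W = 2 * (real n - 2)"
      unfolding W_def by (rule deficit_identity[OF n(1) y(2,3)])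
    have mu: "\<mu> > 6" using True n by simp
    have cH: "card H = 3 * p + r" using card_H n pr by simp
    have W_ge: "2 * real r * (3 - real r) \<le> W * (\<mu> - 2 * real r)"
      unfolding W_def by (rule deficit_bound(1)[OF K mu cH pr(2) y(1,2)])
    \<comment> \<open>The cubic of the extremal graph, evaluated at the index of \<open>G\<close>,
      measures how far the deficit is above its minimum.\<close>
    have c: "F33_poly n r \<mu> = 4 * real r * (3 - real r) - 2 * (W * (\<mu> - 2 * real r))"
    proof -
      have "(\<mu> - 6) * (\<mu> - real n) - 2 * (real n - 2) = - 2 * W" using id by simp
      then show ?thesis unfolding F33_poly_eq' by simp
    qed
    have "F33_poly n r \<mu> \<le> 0" using W_ge c by simp
    then have "\<mu> \<le> \<rho>" using n by (intro F33_poly_root_max[OF _ pr(2) \<rho>]) auto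
    moreover have "graph_iso G (F33 n)" if "\<mu> = \<rho>"
    proof -
      have "W * (\<mu> - 2 * real r) = 2 * real r * (3 - real r)" using c \<rho>(2) that by simp
      then have "\<exists>X\<subseteq>H. card X = r \<and> (\<forall>a\<in>X. h a = X - {a}) \<and> (\<forall>a\<in>H - X. card (h a) = 2)"
        unfolding W_def by (rule deficit_bound(2)[OF K mu cH pr(2) y(1,2), rotated -1])
      then obtain X where "X \<subseteq> H" "card X = r"
        "\<forall>a\<in>X. h a = X - {a}" "\<forall>a\<in>H - X. card (h a) = 2" by blast
      then show ?thesis by (intro graph_iso_F33[OF K n(1) pr]) auto
    qed
    ultimately show ?thesis by blast
  qed
  then show "q_index G \<le> \<rho>" "q_index G = \<rho> \<Longrightarrow> graph_iso G (F33 n)" by (auto simp: \<mu>_def)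
qed

theorem theorem1p4:
  fixes G :: "'a graph" and n p r :: nat
  assumes "simple_graph G"
    and "card (verts G) = n"
    and "n \<ge> 1186"
    and "\<not> has_minor G (complete_bipartite 3 3)"
    and "n - 2 = 3 * p + r" and "r < 3"
  shows "q_index G \<le> q_index (F33 n)
    \<and> (q_index G = q_index (F33 n) \<longleftrightarrow> graph_iso G (F33 n))
    \<and> (let c = (\<lambda>x::real. x^3 - (real n + 2 * real r + 6) * x^2
                 + (12 * real r + 4 * real n + 2 * real r * real n + 4) * x
                 + 4 * real r - 8 * real r * real n - 4 * (real r)^2)
       in c (q_index (F33 n)) = 0 \<and> (\<forall>x. c x = 0 \<longrightarrow> x \<le> q_index (F33 n)))"
proof -
  have n: "n \<ge> 10" using assms(3) by simp
  obtain \<rho> where \<rho>: "\<rho> > real n + 2" "F33_poly n r \<rho> = 0"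
    by (rule F33_poly_root_exists[OF n assms(6)])
  have q: "q_index (F33 n) = \<rho>" by (rule q_index_F33[OF n assms(5,6) \<rho>])
  have "\<forall>x. F33_poly n r x = 0 \<longrightarrow> x \<le> \<rho>"
    using F33_poly_root_max[OF n assms(6) \<rho>] by simp
  moreover have "q_index G = \<rho> \<longleftrightarrow> graph_iso G (F33 n)"
    using K33_minor_free_q_index(2)[OF assms \<rho>] q_index_iso[of G "F33 n"] q by auto
  ultimately show ?thesis
    using K33_minor_free_q_index(1)[OF assms \<rho>] \<rho>(2) unfolding q Let_def F33_poly_def by blast
qed

end
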